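(* Let $m\geq 1$, $1\leq p<2$, and let $\omega$ be a continuous nondecreasing function on $[0,+\infty)$ with $\omega(0)=0$; let $\chi(\delta)=\delta\,\omega(\delta)$ and let $\chi^{-1}$ be the inverse function of $\chi$. Let $\varphi\in C^{1,\omega}(\mathbb T^m)$ be a real function such that the set $\nabla\varphi(\mathbb T^m)$ has positive Lebesgue measure. Then there is a constant $c=c(p,\varphi)>0$, independent of $\lambda$, such that $$\|e^{i\lambda\varphi}\|_{A_p(\mathbb T^m)}\geq c\Big(|\lambda|^{1/p}\chi^{-1}\Big(\frac{1}{|\lambda|}\Big)\Big)^m$$ for all $\lambda\in\Lambda(\varphi,p)$ with $|\lambda|\geq 1$.
   Context: $\mathbb T^m=\mathbb R^m/2\pi\mathbb Z^m$; functions on $\mathbb T^m$ are identified with functions on $\mathbb R^m$ that are $2\pi$-periodic in each variable. For integrable $f$ on $\mathbb T^m$, $\widehat f(k)=(2\pi)^{-m}\int_{\mathbb T^m}f(t)e^{-i(k,t)}dt$, $k\in\mathbb Z^m$. $A_1(\mathbb T^m)$ is the space of continuous $f$ on $\mathbb T^m$ with $\widehat f\in l^1(\mathbb Z^m)$; for $1<p\le 2$, $A_p(\mathbb T^m)$ is the space of integrable $f$ on $\mathbb T^m$ with $\widehat f\in l^p(\mathbb Z^m)$; $\|f\|_{A_p(\mathbb T^m)}=\big(\sum_{k\in\mathbb Z^m}|\widehat f(k)|^p\big)^{1/p}$. For a function $\varphi$ on $\mathbb T^m$, $\Lambda(\varphi,p)$ is the set of all $\lambda\in\mathbb R$ such that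 $e^{i\lambda\varphi}\in A_p(\mathbb T^m)$. For a domain $V\subseteq\mathbb R^m$ and a function $g$ on $V$, $\omega(V,g,\delta)=\sup\{|g(t_1)-g(t_2)|: t_1,t_2\in V, |t_1-t_2|\le\delta\}$; $g\in\mathrm{Lip}_\omega(V)$ means $\omega(V,g,\delta)=O(\omega(\delta))$ as $\delta\to+0$. $C^{1,\omega}(V)$ is the class of functions on $V$ all of whose first-order partial derivatives belong to $\mathrm{Lip}_\omega(V)$. $C^{1,\omega}(\mathbb T^m)$ is the class of functions $2\pi$-periodic in each variable belonging to $C^{1,\omega}(\mathbb R^m)$. *)

theory Defs
  imports "HOL-Analysis.Analysis"
begin

text \<open>The torus T^m is modelled by real^'m (functions 2pi-periodic in each variable);
  the fundamental domain is the box [0,2pi]^m.\<close>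

definition torus_box :: "(real^'m) set" where
  "torus_box = cbox 0 (\<chi> i. 2 * pi)"

definition periodic_torus :: "(real^'m \<Rightarrow> 'b) \<Rightarrow> bool" where
  "periodic_torus f \<longleftrightarrow> (\<forall>x i. f (x + (2 * pi) *\<^sub>R axis i 1) = f x)"

definition fourier_coeff :: "(real^'m \<Rightarrow> complex) \<Rightarrow> int^'m \<Rightarrow> complex" where
  "fourier_coeff f k =
     complex_of_real ((2 * pi) powi (- int CARD('m))) *
     integral torus_box (\<lambda>t. f t * cis (- (\<Sum>i\<in>UNIV. of_int (k $ i) * t $ i)))"

definition in_Ap :: "real \<Rightarrow> (real^'m \<Rightarrow> complex) \<Rightarrow> bool" where
  "in_Ap p f \<longleftrightarrow>
     (if p = 1 then continuous_on UNIV f else f absolutely_integrable_on torus_box) \<and>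
     (\<lambda>k. norm (fourier_coeff f k) powr p) summable_on (UNIV :: (int^'m) set)"

definition Ap_norm :: "real \<Rightarrow> (real^'m \<Rightarrow> complex) \<Rightarrow> real" where
  "Ap_norm p f = (\<Sum>\<^sub>\<infinity>k\<in>(UNIV :: (int^'m) set). norm (fourier_coeff f k) powr p) powr (1 / p)"

definition Lambda_set :: "(real^'m \<Rightarrow> real) \<Rightarrow> real \<Rightarrow> real set" where
  "Lambda_set \<phi> p = {l. in_Ap p (\<lambda>t. cis (l * \<phi> t))}"

definition modulus_cont :: "'a::metric_space set \<Rightarrow> ('a \<Rightarrow> real) \<Rightarrow> real \<Rightarrow> ereal" where
  "modulus_cont V g \<delta> = Sup {ereal \<bar>g t1 - g t2\<bar> | t1 t2. t1 \<in> V \<and> t2 \<in> V \<and> dist t1 t2 \<le> \<delta>}"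

definition Lip_omega :: "(real \<Rightarrow> real) \<Rightarrow> 'a::metric_space set \<Rightarrow> ('a \<Rightarrow> real) \<Rightarrow> bool" where
  "Lip_omega \<omega> V g \<longleftrightarrow>
     (\<exists>C. \<forall>\<^sub>F \<delta> in at_right 0. modulus_cont V g \<delta> \<le> ereal (C * \<bar>\<omega> \<delta>\<bar>))"

definition has_partial_deriv :: "(real^'m \<Rightarrow> real) \<Rightarrow> 'm \<Rightarrow> real^'m \<Rightarrow> real \<Rightarrow> bool" where
  "has_partial_deriv \<phi> i x D \<longleftrightarrow> ((\<lambda>s. \<phi> (x + s *\<^sub>R axis i 1)) has_real_derivative D) (at 0)"

definition C1_omega :: "(real \<Rightarrow> real) \<Rightarrow> (real^'m \<Rightarrow> real) \<Rightarrow> bool" where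
  "C1_omega \<omega> \<phi> \<longleftrightarrow>
     (\<forall>i. (\<forall>x. \<exists>D. has_partial_deriv \<phi> i x D) \<and>
          Lip_omega \<omega> UNIV (\<lambda>x. THE D. has_partial_deriv \<phi> i x D))"

definition C1_omega_torus :: "(real \<Rightarrow> real) \<Rightarrow> (real^'m \<Rightarrow> real) \<Rightarrow> bool" where
  "C1_omega_torus \<omega> \<phi> \<longleftrightarrow> periodic_torus \<phi> \<and> C1_omega \<omega> \<phi>"

definition gradient :: "(real^'m \<Rightarrow> real) \<Rightarrow> real^'m \<Rightarrow> real^'m" where
  "gradient \<phi> x = (\<chi> i. THE D. has_partial_deriv \<phi> i x D)"

end

theory Submission
  imports Defs
begin

text \<open>
  Let \<open>g = cis (l * \<phi>)\<close> and \<open>\<delta> = \<chi>^(-1)(1/|l|)\<close>. On a ball of radius \<open>r = \<eta> \<delta>\<close> around any point \<open>u\<close> the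
  first-order Taylor error of \<open>l * \<phi>\<close> is at most a constant times \<open>|l| r \<omega>(r)\<close>, hence small, so there
  \<open>g\<close> is close to a multiple of the character with frequency \<open>n = round(l \<nabla>\<phi>(u))\<close>. Testing \<open>g\<close> against that
  character times a nonnegative trigonometric polynomial of degree \<open>O(1/r)\<close> that concentrates on the
  ball shows that a weighted average of \<open>|g^|\<close> over the frequencies within \<open>O(1/r)\<close> of \<open>n\<close> is bounded
  below, the total weight being \<open>O(r^(-m))\<close>. By Jensen's inequality, summation over all such \<open>n\<close>
  bounds their number by \<open>O(r^(-mp))\<close> times the p-th power of the norm. Finally, the cubes of side
  \<open>1/|l|\<close> around the points \<open>n / l\<close> cover the range of the gradient, so there are at least
  \<open>|l|^m\<close> times its measure many \<open>n\<close>.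
\<close>

subsection \<open>Weighted sums and kernel coefficients on the integer lattice\<close>

text \<open>Inside the open half-line this is the known convexity of powers. When an argument is 0
  the inequality reduces to s powr p <= s for 0 < s < 1, which is where p >= 1 enters.\<close>

lemma convex_on_powr_nonneg:
  assumes "p \<ge> 1"
  shows "convex_on {0..} (\<lambda>x::real. x powr p)"
proof (rule convex_onI)
  fix t x y :: real
  assume t: "0 < t" "t < 1" and xy: "x \<in> {0..}" "y \<in> {0..}"
  have *: "(s * z) powr p \<le> s * z powr p" if "0 < s" "s < 1" "0 \<le> z" for s z :: real
  proof -
    have "s powr p \<le> s powr 1" using that assms by (intro powr_mono') auto
    then show ?thesis using that by (simp add: powr_mult mult_right_mono)
  qed
  consider "x = 0" | "y = 0" | "x > 0" "y > 0" using xy by fastforce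
  then show "((1 - t) *\<^sub>R x + t *\<^sub>R y) powr p \<le> (1 - t) * x powr p + t * y powr p"
  proof cases
    case 3
    then show ?thesis using convex_onD[OF powr_convex[OF assms], of t x y] t by simp
  qed (use t xy assms *[of t y] *[of "1 - t" x] in auto)
qed simp

text \<open>Convexity of the p-th power, applied after dividing by the total weight. The weights
  stay unnormalised because they will be products of kernel coefficients; the normalisation
  reappears as the factor with exponent p - 1.\<close>

lemma jensen_powr:
  fixes w y :: "'a \<Rightarrow> real"
  assumes "finite S" "p \<ge> 1" "\<And>i. i \<in> S \<Longrightarrow> 0 \<le> w i" "\<And>i. i \<in> S \<Longrightarrow> 0 \<le> y i"
  shows "(\<Sum>i\<in>S. w i * y i) powr p \<le> (\<Sum>i\<in>S. w i) powr (p - 1) * (\<Sum>i\<in>S. w i * y i powr p)"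
\<comment> \<open>With total weight 0 every weight vanishes, and both sides are 0 because
  \<open>0 powr p = 0\<close>.\<close>
proof (cases "(\<Sum>i\<in>S. w i) = 0")
  case True
  then have "\<forall>i\<in>S. w i = 0" using assms by (simp add: sum_nonneg_eq_0_iff)
  then show ?thesis using assms by simp
next
  case False
  define W where "W = (\<Sum>i\<in>S. w i)"
  have W: "W > 0" using False assms by (simp add: W_def sum_nonneg order_less_le)
  have "S \<noteq> {}" using False by auto
  have "(\<Sum>i\<in>S. (w i / W) *\<^sub>R y i) powr p \<le> (\<Sum>i\<in>S. (w i / W) * y i powr p)"
    by (rule convex_on_sum[OF assms(1) \<open>S \<noteq> {}\<close> convex_on_powr_nonneg[OF assms(2)]])
       (use W assms in \<open>auto simp: W_def simp flip: sum_divide_distrib\<close>)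
  then have "((\<Sum>i\<in>S. w i * y i) / W) powr p \<le> (\<Sum>i\<in>S. w i * y i powr p) / W"
    by (simp add: sum_divide_distrib)
  moreover have "0 \<le> (\<Sum>i\<in>S. w i * y i)" using assms by (simp add: sum_nonneg)
  ultimately have "(\<Sum>i\<in>S. w i * y i) powr p \<le> W powr p / W * (\<Sum>i\<in>S. w i * y i powr p)"
    using W by (simp add: powr_divide field_simps)
  also have "W powr p / W = W powr (p - 1)" using W by (simp add: powr_diff)
  finally show ?thesis by (simp add: W_def)
qed

section \<open>Tent coefficients on a lattice cube\<close>

lemma card_int_box:
  fixes A :: "int set"
  assumes "finite A"
  shows "finite {k::int^'m. \<forall>i. k$i \<in> A}" "card {k::int^'m. \<forall>i. k$i \<in> A} = card A ^ CARD('m)"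
proof -
  have bij: "bij_betw vec_lambda (PiE (UNIV::'m set) (\<lambda>_. A)) {k::int^'m. \<forall>i. k$i \<in> A}"
    by (rule bij_betw_byWitness[where f' = vec_nth]) (auto simp: PiE_def)
  have "finite (PiE (UNIV::'m set) (\<lambda>_. A))" using assms by (intro finite_PiE) auto
  then show "finite {k::int^'m. \<forall>i. k$i \<in> A}" using bij bij_betw_finite by blast
  show "card {k::int^'m. \<forall>i. k$i \<in> A} = card A ^ CARD('m)"
    using bij_betw_same_card[OF bij] by (simp add: card_PiE)
qed

text \<open>The witness is a tent over the l^1 norm. One unit step changes it by at most 1, whereas
  it is at least m N on a cube whose size is comparable with that of its support. In l^2 its
  differences are therefore smaller than its values by a factor of order N, which makes the kernel
  concentrate at scale 1 / N.\<close>

lemma kernel_coeffs_exist: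
  fixes N :: nat
  assumes "N \<ge> 1"
  defines "m \<equiv> CARD('m::finite)"
  obtains a :: "int^'m \<Rightarrow> real" and S where
    "finite S" "\<And>k. 0 \<le> a k" "\<And>k. k \<notin> S \<Longrightarrow> a k = 0"
    "\<And>k i. k \<notin> S \<Longrightarrow> a (k - axis i 1) = 0"
    "0 < (\<Sum>k\<in>S. (a k)\<^sup>2)" "real (card S) \<le> (5 * real m * real N) ^ m"
    "\<And>i. (\<Sum>k\<in>S. (a k - a (k - axis i 1))\<^sup>2) \<le> (2 * real m) ^ m / (real m * real N)\<^sup>2 * (\<Sum>k\<in>S. (a k)\<^sup>2)"
proof -
  \<comment> \<open>On the cube \<open>T\<close> the l^1 norm is at most m N; a tent of twice that
    height still has value at least m N there.\<close>
  define M :: int where "M = 2 * int m * int N"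
  define h :: "int^'m \<Rightarrow> int" where "h = (\<lambda>k. \<Sum>i\<in>UNIV. \<bar>k $ i\<bar>)"
  define a :: "int^'m \<Rightarrow> real" where "a = (\<lambda>k. of_int (max 0 (M - h k)))"
  define S where "S = {k::int^'m. \<forall>i. k $ i \<in> {-M..M}}"
  define T where "T = {k::int^'m. \<forall>i. k $ i \<in> {-int N..int N}}"
  have m: "m \<ge> 1" by (simp add: m_def Suc_leI)
  have h_ge: "\<bar>k $ i\<bar> \<le> h k" for k i
    unfolding h_def by (rule member_le_sum) auto
  have h_diff: "\<bar>h k - h (k - axis i 1)\<bar> \<le> 1" for k i
  proof -
    have "\<bar>h k - h (k - axis i 1)\<bar> \<le> (\<Sum>j\<in>UNIV. \<bar>\<bar>k $ j\<bar> - \<bar>(k - axis i 1) $ j\<bar>\<bar>)"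
      unfolding h_def sum_subtractf[symmetric] by (rule sum_abs)
    also have "\<dots> \<le> (\<Sum>j\<in>UNIV. if j = i then 1 else 0)"
      by (rule sum_mono) (auto simp: axis_def)
    finally show ?thesis by simp
  qed
  have "2 * M + 1 = int (4 * m * N + 1)" by (simp add: M_def)
  then have "M - (- M) + 1 = int (4 * m * N + 1)" by linarith
  then have cardM: "card {-M..M} = 4 * m * N + 1" by (simp only: card_atLeastAtMost_int nat_int)
  have finS: "finite S" and cS: "card S = (4 * m * N + 1) ^ m"
    using card_int_box[of "{-M..M}", where 'm='m] cardM by (simp_all add: S_def m_def del: card_atLeastAtMost_int)
  have "int N - (- int N) + 1 = int (2 * N + 1)" by simp
  then have cardN: "card {-int N..int N} = 2 * N + 1" by (simp only: card_atLeastAtMost_int nat_int)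
  have finT: "finite T" and cT: "card T = (2 * N + 1) ^ m"
    using card_int_box[of "{-int N..int N}", where 'm='m] cardN by (simp_all add: T_def m_def del: card_atLeastAtMost_int)
  \<comment> \<open>Strictness leaves room for one unit step: the shifted point still has l^1 norm
    at least \<open>M\<close>, where the tent is 0.\<close>
  have S0: "h k > M" if "k \<notin> S" for k
  proof -
    from that obtain i where "k $ i \<notin> {-M..M}" unfolding S_def by blast
    then have "\<bar>k $ i\<bar> > M" by auto
    then show ?thesis using h_ge[of k i] by simp
  qed
  have TS: "T \<subseteq> S"
  proof -
    have "int N * 1 \<le> int N * (2 * int m)" using m by (intro mult_left_mono) auto
    then have "int N \<le> M" by (simp add: M_def algebra_simps)
    then have "{-int N..int N} \<subseteq> {-M..M}" by auto
    then show ?thesis unfolding T_def S_def by blast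
  qed
  have aT: "a k \<ge> m * N" if "k \<in> T" for k
  proof -
    have "h k \<le> (\<Sum>i\<in>(UNIV::'m set). int N)"
      unfolding h_def using that by (intro sum_mono) (auto simp: T_def abs_le_iff minus_le_iff)
    then have "int m * int N \<le> M - h k" by (simp add: M_def m_def mult_ac)
    then have "int m * int N \<le> max 0 (M - h k)" by linarith
    then have "real_of_int (int m * int N) \<le> a k" unfolding a_def of_int_le_iff .
    then show ?thesis by simp
  qed
  have low: "(2 * N + 1) ^ m * (m * N)\<^sup>2 \<le> (\<Sum>k\<in>S. (a k)\<^sup>2)"
  proof -
    have "(2 * N + 1) ^ m * (m * N)\<^sup>2 = (\<Sum>k\<in>T. (real (m * N))\<^sup>2)" by (simp add: cT)
    also have "\<dots> \<le> (\<Sum>k\<in>T. (a k)\<^sup>2)" using aT by (intro sum_mono power_mono) auto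
    also have "\<dots> \<le> (\<Sum>k\<in>S. (a k)\<^sup>2)" using TS finS by (intro sum_mono2) auto
    finally show ?thesis .
  qed
  have mN: "real (m * N) \<ge> 1" using m assms(1) by (metis mult_le_mono of_nat_mono mult_1 of_nat_1)
  have posq: "(2 * real N + 1) ^ m * (real m * real N)\<^sup>2 > 0" using m assms(1) by (intro mult_pos_pos zero_less_power) auto
  show thesis
  proof (rule that[of S a])
    show "0 \<le> a k" for k by (simp add: a_def)
    show "a k = 0" if "k \<notin> S" for k using S0[OF that] by (simp add: a_def)
    show "a (k - axis i 1) = 0" if "k \<notin> S" for k i
      using S0[OF that] h_diff[of k i] by (simp add: a_def)
    show "0 < (\<Sum>k\<in>S. (a k)\<^sup>2)" using low posq by (simp add: add.commute)
    have "(4 * m * N + 1) ^ m \<le> (5 * m * N) ^ m" using m assms(1) by (intro power_mono) auto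
    then show "real (card S) \<le> (5 * real m * real N) ^ m" unfolding cS
      by (metis of_nat_le_iff of_nat_mult of_nat_numeral of_nat_power)
    show "(\<Sum>k\<in>S. (a k - a (k - axis i 1))\<^sup>2) \<le> (2 * real m) ^ m / (real m * real N)\<^sup>2 * (\<Sum>k\<in>S. (a k)\<^sup>2)" for i
    proof -
      have "\<bar>a k - a (k - axis i 1)\<bar> \<le> 1" for k
      proof -
        have "\<bar>max 0 (M - h k) - max 0 (M - h (k - axis i 1))\<bar> \<le> 1"
          using h_diff[of k i] by linarith
        then show ?thesis unfolding a_def by (simp only: of_int_diff[symmetric] of_int_abs[symmetric] of_int_le_1_iff)
      qed
      then have "(a k - a (k - axis i 1))\<^sup>2 \<le> 1" for k using abs_square_le_1 by blast
      then have "(\<Sum>k\<in>S. (a k - a (k - axis i 1))\<^sup>2) \<le> (\<Sum>k\<in>S. 1)" by (rule sum_mono)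
      also have "\<dots> = real ((4 * m * N + 1) ^ m)" by (simp add: cS)
      \<comment> \<open>The inequality 4 m N + 1 <= 2 m (2 N + 1) compares the sides of
        \<open>S\<close> and \<open>T\<close> and produces the factor (2 m)^m.\<close>
      also have "\<dots> \<le> real ((2 * m * (2 * N + 1)) ^ m)"
        unfolding of_nat_le_iff using m by (intro power_mono) (auto simp: algebra_simps)
      also have "\<dots> = real ((2 * m) ^ m) * real ((2 * N + 1) ^ m)"
        by (simp only: power_mult_distrib of_nat_mult)
      also have "\<dots> = (2 * real m) ^ m / (real m * real N)\<^sup>2 * ((2 * N + 1) ^ m * (m * N)\<^sup>2)"
        using m assms(1) by simp
      also have "\<dots> \<le> (2 * real m) ^ m / (real m * real N)\<^sup>2 * (\<Sum>k\<in>S. (a k)\<^sup>2)"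
        using low by (intro mult_left_mono) auto
      finally show ?thesis .
    qed
  qed (rule finS)
qed

text \<open>For each \<open>n\<close>, Jensen with the weights \<open>a k * a l\<close> moves the
  p-th power onto the values of \<open>b\<close>. After exchanging the sums, each pair (k, l)
  contributes a sum of \<open>b powr p\<close> over a translate of \<open>B\<close>, which is at
  most the full sum.\<close>

lemma count_le_lp_sum:
  fixes a :: "int^'m \<Rightarrow> real" and b :: "int^'m \<Rightarrow> real"
  assumes S: "finite S" "\<And>k. 0 \<le> a k" and p: "p \<ge> 1"
    and b: "\<And>k. 0 \<le> b k" "(\<lambda>k. b k powr p) summable_on UNIV"
    and B: "finite B" and A: "0 \<le> A"
    and low: "\<And>n. n \<in> B \<Longrightarrow> A \<le> (\<Sum>k\<in>S. \<Sum>l\<in>S. a k * a l * b (n - k + l))"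
  shows "real (card B) * A powr p \<le> ((\<Sum>k\<in>S. a k)\<^sup>2) powr p * (\<Sum>\<^sub>\<infinity>k. b k powr p)"
proof -
  define W where "W = (\<Sum>k\<in>S. a k)\<^sup>2"
  define I where "I = (\<Sum>\<^sub>\<infinity>k. b k powr p)"
  define w where "w = (\<lambda>(k, l). a k * a l)"
  have W: "(\<Sum>z\<in>S \<times> S. w z) = W"
    by (simp add: W_def w_def power2_eq_square sum_product sum.cartesian_product)
  have Wge: "W \<ge> 0" by (simp add: W_def)
  have w0: "0 \<le> w z" for z using S by (auto simp: w_def split: prod.split)
  have bI: "(\<Sum>n\<in>B. b (n - k + l) powr p) \<le> I" for k l
  proof -
    have "inj (\<lambda>n. n - k + l)" by (rule injI) simp
    then have "(\<Sum>n\<in>B. b (n - k + l) powr p) = (\<Sum>n\<in>(\<lambda>n. n - k + l) ` B. b n powr p)"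
      by (subst sum.reindex) (auto simp: inj_on_def)
    also have "\<dots> \<le> I" unfolding I_def using b B by (intro finite_sum_le_infsum) auto
    finally show ?thesis .
  qed
  have "real (card B) * A powr p = (\<Sum>n\<in>B. A powr p)" by simp
  also have "\<dots> \<le> (\<Sum>n\<in>B. (\<Sum>z\<in>S \<times> S. w z * b (n - fst z + snd z)) powr p)"
  proof (rule sum_mono)
    fix n assume "n \<in> B"
    then show "A powr p \<le> (\<Sum>z\<in>S \<times> S. w z * b (n - fst z + snd z)) powr p"
      using low[of n] A p by (intro powr_mono2) (auto simp: w_def sum.cartesian_product case_prod_unfold)
  qed
  also have "\<dots> \<le> (\<Sum>n\<in>B. W powr (p - 1) * (\<Sum>z\<in>S \<times> S. w z * b (n - fst z + snd z) powr p))"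
    unfolding W[symmetric] by (intro sum_mono jensen_powr) (use S b p w0 in auto)
  also have "\<dots> = W powr (p - 1) * (\<Sum>z\<in>S \<times> S. w z * (\<Sum>n\<in>B. b (n - fst z + snd z) powr p))"
    by (subst sum_distrib_left[symmetric], subst sum.swap) (simp add: sum_distrib_left)
  also have "\<dots> \<le> W powr (p - 1) * (\<Sum>z\<in>S \<times> S. w z * I)"
    by (intro mult_left_mono sum_mono bI w0) auto
  also have "\<dots> = W powr (p - 1) * W * I" by (simp add: W flip: sum_distrib_right)
  also have "W powr (p - 1) * W = W powr p"
    using Wge by (cases "W = 0") (auto simp: powr_diff)
  finally show ?thesis by (simp add: W_def I_def)
qed

subsection \<open>Characters and trigonometric polynomials\<close>

text \<open>Lebesgue measure is the image of the product measure under assembling coordinates, so a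
  product of one-variable functions integrates factor by factor.\<close>

lemma lborel_integral_prod_Basis:
  fixes f :: "'a::euclidean_space \<Rightarrow> real \<Rightarrow> complex"
  assumes "\<And>b. b \<in> Basis \<Longrightarrow> integrable lborel (f b)"
  shows "integrable lborel (\<lambda>x::'a. \<Prod>b\<in>Basis. f b (x \<bullet> b))"
    and "(\<integral>x. (\<Prod>b\<in>Basis. f b (x \<bullet> b)) \<partial>lborel) = (\<Prod>b\<in>(Basis::'a set). \<integral>x. f b x \<partial>lborel)"
proof -
  interpret product_sigma_finite "\<lambda>_::'a. lborel :: real measure" ..
  have [measurable]: "f b \<in> borel_measurable borel" if "b \<in> Basis" for b
    using assms[OF that, THEN borel_measurable_integrable] by simp
  have meas: "(\<lambda>x::'a. \<Prod>b\<in>Basis. f b (x \<bullet> b)) \<in> borel_measurable borel" by measurable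
  have emb: "(\<lambda>g. \<Sum>b\<in>Basis. g b *\<^sub>R b) \<in> measurable (\<Pi>\<^sub>M b\<in>(Basis::'a set). (lborel::real measure)) borel"
    by measurable
  have eq: "(\<Prod>b\<in>Basis. f b ((\<Sum>c\<in>Basis. g c *\<^sub>R c) \<bullet> b)) = (\<Prod>b\<in>Basis. f b (g b))"
    for g :: "'a \<Rightarrow> real" by simp
  have "integrable (\<Pi>\<^sub>M b\<in>(Basis::'a set). lborel) (\<lambda>g. \<Prod>b\<in>Basis. f b (g b))"
    using assms by (intro product_integrable_prod) auto
  then show "integrable lborel (\<lambda>x::'a. \<Prod>b\<in>Basis. f b (x \<bullet> b))"
    by (subst lborel_eq, subst integrable_distr_eq[OF emb meas]) (simp only: eq)
  show "(\<integral>x. (\<Prod>b\<in>Basis. f b (x \<bullet> b)) \<partial>lborel) = (\<Prod>b\<in>(Basis::'a set). \<integral>x. f b x \<partial>lborel)"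
    by (subst lborel_eq, subst integral_distr[OF emb meas], subst eq,
        subst product_integral_prod) (use assms in auto)
qed

text \<open>The one-dimensional case of orthogonality. The indicator turns the integral over a
  period into one over the line, as the product formula requires.\<close>

lemma integral_cis_period:
  fixes k :: int
  defines "f \<equiv> \<lambda>s::real. indicator {0..2 * pi} s *\<^sub>R cis (of_int k * s)"
  shows "integrable lborel f" "integral\<^sup>L lborel f = (if k = 0 then of_real (2 * pi) else 0)"
proof -
  have cont: "continuous_on {0..2 * pi} (\<lambda>s. cis (of_int k * s))"
    by (intro continuous_intros)
  show int: "integrable lborel f"
    using borel_integrable_atLeastAtMost'[OF cont] by (simp add: f_def set_integrable_def)
  have "integral\<^sup>L lborel f = integral {0..2 * pi} (\<lambda>s. cis (of_int k * s))"
    using set_borel_integral_eq_integral(2)[of "{0..2 * pi}" "\<lambda>s. cis (of_int k * s)"] int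
    by (simp add: f_def set_integrable_def set_lebesgue_integral_def)
  also have "\<dots> = (if k = 0 then of_real (2 * pi) else 0)"
  proof (cases "k = 0")
    case False
    have deriv: "((\<lambda>z. exp (\<i> * of_int k * z) / (\<i> * of_int k)) has_field_derivative exp (\<i> * of_int k * z)) (at z)"
      for z :: complex
      by (auto intro!: derivative_eq_intros simp: False)
    have "((\<lambda>s. cis (of_int k * s)) has_integral
        (cis (of_int k * (2 * pi)) / (\<i> * of_int k) - cis (of_int k * 0) / (\<i> * of_int k))) {0..2 * pi}"
    proof (rule fundamental_theorem_of_calculus)
      fix x
      show "((\<lambda>s. cis (of_int k * s) / (\<i> * of_int k)) has_vector_derivative cis (of_int k * x))
              (at x within {0..2 * pi})"
        using has_vector_derivative_real_field[OF deriv] by (simp add: cis_conv_exp mult_ac)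
    qed simp
    moreover have "cis (of_int k * (2 * pi)) = 1"
      using cis_multiple_2pi[of "of_int k"] by (simp add: mult.commute mult.left_commute)
    ultimately show ?thesis using False by (simp add: integral_unique)
  qed (simp add: scaleR_conv_of_real)
  finally show "integral\<^sup>L lborel f = (if k = 0 then of_real (2 * pi) else 0)" .
qed

text \<open>For |x| <= 2 the Maclaurin remainder |x|^3 / 6 is at most 2|x| / 3. This range contains
  the half-angles up to pi / 2 that occur on the torus.\<close>

lemma sin_ge_third:
  fixes x :: real
  assumes "\<bar>x\<bar> \<le> 2"
  shows "\<bar>x\<bar> / 3 \<le> \<bar>sin x\<bar>"
proof -
  have "\<bar>sin x - (\<Sum>m<3. sin_coeff m * x ^ m)\<bar> \<le> inverse (fact 3) * \<bar>x\<bar> ^ 3"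
    by (rule Maclaurin_sin_bound)
  then have "\<bar>sin x - x\<bar> \<le> \<bar>x\<bar> ^ 3 / 6"
    by (simp add: sin_coeff_def numeral_3_eq_3 eval_nat_numeral fact_numeral)
  moreover have "\<bar>x\<bar> ^ 3 \<le> 4 * \<bar>x\<bar>"
  proof -
    have "\<bar>x\<bar> * \<bar>x\<bar> \<le> 2 * 2" using assms by (intro mult_mono) auto
    then have "\<bar>x\<bar> * \<bar>x\<bar> * \<bar>x\<bar> \<le> 4 * \<bar>x\<bar>" by (intro mult_right_mono) auto
    then show ?thesis by (simp add: power3_eq_cube)
  qed
  ultimately show ?thesis by linarith
qed

lemma norm_cis_minus_1: "norm (cis s - 1) = 2 * \<bar>sin (s / 2)\<bar>"
  using dist_exp_i_1[of s] by (simp add: cis_conv_exp)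

section \<open>Characters of the torus\<close>

definition character :: "int^'m \<Rightarrow> real^'m \<Rightarrow> complex" where
  "character k t = cis (\<Sum>i\<in>UNIV. of_int (k $ i) * t $ i)"

lemma character_simps [simp]:
  "character 0 t = 1" "character k 0 = 1" "norm (character k t) = 1"
  by (simp_all add: character_def)

lemma character_add: "character (k + l) t = character k t * character l t"
  by (simp add: character_def cis_mult distrib_right sum.distrib)

lemma character_minus: "character (- k) t = cnj (character k t)"
  by (simp add: character_def cis_cnj sum_negf)

lemma character_diff: "character (k - l) t = character k t * cnj (character l t)"
  using character_add[of k "- l" t] by (simp add: character_minus)

lemma character_diff_right: "character k (t - u) = character k t * character (- k) u"
  by (simp add: character_def cis_mult algebra_simps sum_subtractf sum_negf)

lemma character_axis: "character (axis i 1) t = cis (t $ i)"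
proof -
  have "(\<Sum>j\<in>UNIV. of_int (axis i 1 $ j) * t $ j) = (\<Sum>j\<in>UNIV. if j = i then t $ j else 0)"
    by (intro sum.cong) (auto simp: axis_def)
  then show ?thesis by (simp add: character_def)
qed

lemma continuous_on_character [continuous_intros]:
  "continuous_on A g \<Longrightarrow> continuous_on A (\<lambda>t. character k (g t))"
  unfolding character_def by (intro continuous_intros)

text \<open>A character cut off to the box is a product over the coordinates, so its integral is a
  product of one-dimensional integrals, and one nonzero component of \<open>k\<close> makes it
  vanish.\<close>

lemma has_integral_character:
  fixes k :: "int^'m"
  shows "(character k has_integral (if k = 0 then of_real ((2 * pi) ^ CARD('m)) else 0)) torus_box"
proof -
  define K :: "real^'m" where "K = (\<chi> i. of_int (k $ i))"
  define f where "f = (\<lambda>(b::real^'m) s. indicator {0..2 * pi} s *\<^sub>R cis (K \<bullet> b * s))"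
  have Kb: "\<exists>j. b = axis j 1 \<and> K \<bullet> b = of_int (k $ j)" if "b \<in> Basis" for b
    using that by (auto simp: Basis_vec_def K_def inner_axis)
  have int: "integrable lborel (f b)" if "b \<in> Basis" for b
    using Kb[OF that] integral_cis_period(1) by (auto simp: f_def)
  have eq: "(\<Prod>b\<in>Basis. f b (x \<bullet> b)) = (if x \<in> torus_box then character k x else 0)" for x :: "real^'m"
  proof (cases "x \<in> torus_box")
    case True
    then have "x \<bullet> b \<in> {0..2 * pi}" if "b \<in> Basis" for b
      using that by (auto simp: torus_box_def mem_box_cart Basis_vec_def inner_axis)
    then have "(\<Prod>b\<in>Basis. f b (x \<bullet> b)) = (\<Prod>b\<in>Basis. cis (K \<bullet> b * (x \<bullet> b)))"
      by (intro prod.cong) (auto simp: f_def)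
    also have "\<dots> = cis (\<Sum>b\<in>Basis. K \<bullet> b * (x \<bullet> b))" by (simp add: cis_conv_exp exp_sum sum_distrib_left)
    also have "(\<Sum>b\<in>Basis. K \<bullet> b * (x \<bullet> b)) = (\<Sum>i\<in>UNIV. of_int (k $ i) * x $ i)"
      by (subst euclidean_inner[symmetric]) (simp add: inner_vec_def K_def)
    finally show ?thesis using True by (simp add: character_def)
  next
    case False
    then obtain i where "x $ i \<notin> {0..2 * pi}" by (auto simp: torus_box_def mem_box_cart)
    then have "f (axis i 1) (x \<bullet> axis i 1) = 0" by (simp add: f_def inner_axis)
    moreover have "axis i 1 \<in> (Basis :: (real^'m) set)" by (simp add: axis_in_Basis_iff)
    ultimately show ?thesis using False by (metis (no_types, lifting) finite_Basis prod_zero)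
  qed
  have "(\<Prod>b\<in>(Basis::(real^'m) set). \<integral>x. f b x \<partial>lborel)
      = (\<Prod>i\<in>UNIV. \<integral>x. f (axis i 1) x \<partial>lborel)"
    unfolding Basis_vec_def
    by (simp add: prod.UNION_disjoint axis_eq_axis)
  also have "\<dots> = (\<Prod>i\<in>UNIV. if k $ i = 0 then complex_of_real (2 * pi) else 0)"
    by (intro prod.cong refl) (simp add: f_def K_def inner_axis integral_cis_period(2))
  also have "\<dots> = (if k = 0 then of_real ((2 * pi) ^ CARD('m)) else 0)"
    by (auto simp: vec_eq_iff)
  finally have "(\<Prod>b\<in>(Basis::(real^'m) set). \<integral>x. f b x \<partial>lborel) =
    (if k = 0 then of_real ((2 * pi) ^ CARD('m)) else 0)" .
  then have "((\<lambda>x. if x \<in> torus_box then character k x else 0) has_integral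
      (if k = 0 then of_real ((2 * pi) ^ CARD('m)) else 0)) UNIV"
    using has_integral_integral_lborel[OF lborel_integral_prod_Basis(1)[of f]]
      lborel_integral_prod_Basis(2)[of f] int by (simp add: eq)
  then show ?thesis by (simp add: has_integral_restrict_UNIV)
qed

section \<open>Squared trigonometric polynomials as test kernels\<close>

lemma norm_square_trig_poly:
  fixes a :: "int^'m \<Rightarrow> real"
  shows "of_real ((norm (\<Sum>k\<in>S. of_real (a k) * character k (t - u)))\<^sup>2) =
     (\<Sum>k\<in>S. \<Sum>l\<in>S. of_real (a k * a l) * character (l - k) u * character (k - l) t)"
  unfolding complex_norm_square cnj_sum sum_product
  by (intro sum.cong refl)
     (simp add: character_diff character_diff_right character_minus)

text \<open>Parseval: in the expanded square only the terms with \<open>k = l\<close> have a nonzero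
  integral, and in these the translation by \<open>u\<close> contributes the factor 1.\<close>

lemma has_integral_norm_square_trig_poly:
  fixes a :: "int^'m \<Rightarrow> real"
  assumes "finite S"
  shows "((\<lambda>t. (norm (\<Sum>k\<in>S. of_real (a k) * character k (t - u)))\<^sup>2) has_integral
           (2 * pi) ^ CARD('m) * (\<Sum>k\<in>S. (a k)\<^sup>2)) torus_box"
proof -
  have "((\<lambda>t. of_real ((norm (\<Sum>k\<in>S. of_real (a k) * character k (t - u)))\<^sup>2)) has_integral
     (\<Sum>k\<in>S. \<Sum>l\<in>S. of_real (a k * a l) * character (l - k) u *
        (if k - l = 0 then complex_of_real ((2 * pi) ^ CARD('m)) else 0))) torus_box"
    unfolding norm_square_trig_poly by (intro has_integral_sum has_integral_mult_right has_integral_character assms)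
  also have "(\<Sum>k\<in>S. \<Sum>l\<in>S. of_real (a k * a l) * character (l - k) u *
        (if k - l = 0 then complex_of_real ((2 * pi) ^ CARD('m)) else 0))
     = (\<Sum>k\<in>S. \<Sum>l\<in>S. if k = l then of_real (a k * a k * (2 * pi) ^ CARD('m)) else 0)"
    by (intro sum.cong refl) auto
  also have "\<dots> = of_real ((2 * pi) ^ CARD('m) * (\<Sum>k\<in>S. (a k)\<^sup>2))"
    using assms by (simp add: sum_distrib_left power2_eq_square mult_ac)
  finally show ?thesis by - (drule has_integral_Re, simp only: Re_complex_of_real)
qed

lemma fourier_coeff_character:
  fixes f :: "real^'m \<Rightarrow> complex"
  shows "integral torus_box (\<lambda>t. f t * character (- k) t) = of_real ((2 * pi) ^ CARD('m)) * fourier_coeff f k"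
proof -
  have nz: "(2 * pi) ^ CARD('m) \<noteq> 0" by simp
  have one: "complex_of_real ((2 * pi) ^ CARD('m)) * of_real ((2 * pi) powi (- int CARD('m))) = 1"
    by (simp only: of_real_mult[symmetric] power_int_minus power_int_of_nat right_inverse[OF nz] of_real_1)
  show ?thesis
    by (simp only: fourier_coeff_def mult.assoc[symmetric] one mult_1)
       (simp add: character_def sum_negf)
qed

text \<open>Expanding the square turns the integral into a combination of Fourier coefficients near
  \<open>n\<close>. The centre \<open>u\<close> enters only through unimodular factors, which the
  triangle inequality removes.\<close>

lemma norm_integral_trig_kernel_le:
  fixes g :: "real^'m \<Rightarrow> complex" and a :: "int^'m \<Rightarrow> real"
  assumes g: "continuous_on UNIV g" and S: "finite S" "\<And>k. 0 \<le> a k"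
  shows "norm (integral torus_box (\<lambda>t. g t * character (- n) t *
            of_real ((norm (\<Sum>k\<in>S. of_real (a k) * character k (t - u)))\<^sup>2)))
    \<le> (2 * pi) ^ CARD('m) * (\<Sum>k\<in>S. \<Sum>l\<in>S. a k * a l * norm (fourier_coeff g (n - k + l)))"
proof -
  have char: "character (- n) t * character (k - l) t = character (- (n - k + l)) t" for k l t
    by (simp add: algebra_simps flip: character_add)
  have "g t * character (- n) t * of_real ((norm (\<Sum>k\<in>S. of_real (a k) * character k (t - u)))\<^sup>2) =
     (\<Sum>k\<in>S. \<Sum>l\<in>S. of_real (a k * a l) * character (l - k) u * (g t * character (- (n - k + l)) t))" for t
    unfolding norm_square_trig_poly sum_distrib_left char[symmetric]
    by (intro sum.cong refl) (simp only: mult_ac)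
  moreover have "((\<lambda>t. \<Sum>k\<in>S. \<Sum>l\<in>S. of_real (a k * a l) * character (l - k) u *
        (g t * character (- (n - k + l)) t)) has_integral
     (\<Sum>k\<in>S. \<Sum>l\<in>S. of_real (a k * a l) * character (l - k) u *
        (of_real ((2 * pi) ^ CARD('m)) * fourier_coeff g (n - k + l)))) torus_box"
    unfolding fourier_coeff_character[symmetric] torus_box_def
    by (intro has_integral_sum has_integral_mult_right integrable_integral S integrable_continuous
        continuous_intros continuous_on_subset[OF g] subset_UNIV)
  ultimately have "integral torus_box (\<lambda>t. g t * character (- n) t *
            of_real ((norm (\<Sum>k\<in>S. of_real (a k) * character k (t - u)))\<^sup>2)) =
      (\<Sum>k\<in>S. \<Sum>l\<in>S. of_real (a k * a l) * character (l - k) u *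
        (of_real ((2 * pi) ^ CARD('m)) * fourier_coeff g (n - k + l)))"
    by (simp only: integral_unique)
  also have "norm \<dots> \<le> (\<Sum>k\<in>S. \<Sum>l\<in>S. norm (of_real (a k * a l) * character (l - k) u *
        (of_real ((2 * pi) ^ CARD('m)) * fourier_coeff g (n - k + l))))"
    by (intro order_trans[OF norm_sum] sum_mono) (rule order_refl)
  also have "\<dots> = (2 * pi) ^ CARD('m) * (\<Sum>k\<in>S. \<Sum>l\<in>S. a k * a l * norm (fourier_coeff g (n - k + l)))"
    unfolding sum_distrib_left
    by (intro sum.cong refl) (simp add: norm_mult S mult_ac norm_power)
  finally show ?thesis .
qed

text \<open>Multiplication by \<open>cis (s $ i)\<close> shifts the coefficients by one unit in
  direction \<open>i\<close>. The vanishing hypotheses allow the shifted and the unshifted sum to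
  run over the same \<open>S\<close>.\<close>

lemma cis_minus_1_mult_trig_poly:
  fixes a :: "int^'m \<Rightarrow> real"
  assumes "finite S" "\<And>k. k \<notin> S \<Longrightarrow> a k = 0" "\<And>k. k \<notin> S \<Longrightarrow> a (k - axis i 1) = 0"
  shows "(cis (s $ i) - 1) * (\<Sum>k\<in>S. of_real (a k) * character k s) =
         - (\<Sum>k\<in>S. of_real (a k - a (k - axis i 1)) * character k s)"
proof -
  have "cis (s $ i) * (\<Sum>k\<in>S. of_real (a k) * character k s)
      = (\<Sum>k\<in>S. of_real (a k) * character (k + axis i 1) s)"
    by (simp add: sum_distrib_left character_add character_axis mult_ac)
  also have "\<dots> = (\<Sum>k\<in>(\<lambda>k. k + axis i 1) ` S. of_real (a (k - axis i 1)) * character k s)"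
    by (subst sum.reindex) auto
  also have "\<dots> = (\<Sum>k\<in>S. of_real (a (k - axis i 1)) * character k s)"
  proof (rule sum.mono_neutral_cong)
    fix k assume k: "k \<in> S - (\<lambda>k. k + axis i 1) ` S"
    then have "k - axis i 1 \<notin> S" by (metis DiffD2 diff_add_cancel image_eqI)
    then show "of_real (a (k - axis i 1)) * character k s = 0" using assms by simp
  qed (use assms in auto)
  finally show ?thesis
    by (simp add: algebra_simps sum_subtractf)
qed

text \<open>The squared modulus of the trigonometric polynomial concentrates near \<open>u\<close>: multiplication
  by \<open>cis ((t - u) $ i) - 1\<close> takes differences of the coefficients, so Parseval turns small
  differences into small second moments.\<close>

lemma fourier_coeff_sum_lower_bound:
  fixes g :: "real^'m \<Rightarrow> complex" and a :: "int^'m \<Rightarrow> real" and R \<kappa> :: real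
  assumes g: "continuous_on UNIV g"
    and S: "finite S" "\<And>k. 0 \<le> a k" "\<And>k. k \<notin> S \<Longrightarrow> a k = 0" "\<And>k i. k \<notin> S \<Longrightarrow> a (k - axis i 1) = 0"
    and diff: "\<And>i. (\<Sum>k\<in>S. (a k - a (k - axis i 1))\<^sup>2) \<le> \<kappa> * (\<Sum>k\<in>S. (a k)\<^sup>2)"
    and R: "0 \<le> R" "R * CARD('m) * \<kappa> \<le> 1 / 4"
    and c: "norm c = 1"
    and near: "\<And>t. norm (g t * character (- n) t - c) \<le> 1 / 4 + R * (\<Sum>i\<in>UNIV. (norm (cis ((t - u) $ i) - 1))\<^sup>2)"
  shows "(\<Sum>k\<in>S. (a k)\<^sup>2) / 2 \<le> (\<Sum>k\<in>S. \<Sum>l\<in>S. a k * a l * norm (fourier_coeff g (n - k + l)))"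
proof -
  define A where "A = (\<Sum>k\<in>S. (a k)\<^sup>2)"
  define P where "P = (2 * pi) ^ CARD('m)"
  define F where "F = (\<lambda>t. \<Sum>k\<in>S. of_real (a k) * character k (t - u))"
  have P: "P > 0" by (simp add: P_def)
  have A: "A \<ge> 0" by (simp add: A_def sum_nonneg)
  have contF: "continuous_on UNIV F" unfolding F_def by (intro continuous_intros)
  have intF: "((\<lambda>t. (norm (F t))\<^sup>2) has_integral P * A) torus_box"
    unfolding F_def P_def A_def by (rule has_integral_norm_square_trig_poly[OF S(1)])
  have intFi: "((\<lambda>t. (norm (cis ((t - u) $ i) - 1))\<^sup>2 * (norm (F t))\<^sup>2) has_integral
        P * (\<Sum>k\<in>S. (a k - a (k - axis i 1))\<^sup>2)) torus_box" for i
  proof -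
    have "(norm (cis ((t - u) $ i) - 1))\<^sup>2 * (norm (F t))\<^sup>2
        = (norm (\<Sum>k\<in>S. of_real (a k - a (k - axis i 1)) * character k (t - u)))\<^sup>2" for t
      unfolding power_mult_distrib[symmetric] norm_mult[symmetric] F_def
      by (subst cis_minus_1_mult_trig_poly) (use S in auto)
    then show ?thesis
      unfolding P_def by (simp only: has_integral_norm_square_trig_poly[OF S(1)])
  qed
  have bound: "((\<lambda>t. 1 / 4 * (norm (F t))\<^sup>2 + R * (\<Sum>i\<in>UNIV. (norm (cis ((t - u) $ i) - 1))\<^sup>2 * (norm (F t))\<^sup>2))
      has_integral (1 / 4 * (P * A) + R * (\<Sum>i\<in>UNIV. P * (\<Sum>k\<in>S. (a k - a (k - axis i 1))\<^sup>2)))) torus_box"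
    by (intro has_integral_add has_integral_mult_right has_integral_sum intF intFi) simp
  \<comment> \<open>The constant 1/4 in \<open>near\<close> and the smallness of R m \<kappa> each
    account for a quarter of P A.\<close>
  have val: "1 / 4 * (P * A) + R * (\<Sum>i\<in>UNIV. P * (\<Sum>k\<in>S. (a k - a (k - axis i 1))\<^sup>2)) \<le> P * (A / 2)"
  proof -
    have "R * (\<Sum>i\<in>UNIV. P * (\<Sum>k\<in>S. (a k - a (k - axis i 1))\<^sup>2))
        \<le> R * (\<Sum>i\<in>(UNIV::'m set). P * (\<kappa> * A))"
      unfolding A_def using R(1) P diff by (intro mult_left_mono sum_mono) auto
    also have "\<dots> = (R * CARD('m) * \<kappa>) * (P * A)" by simp
    also have "\<dots> \<le> 1 / 4 * (P * A)" using R(2) P A by (intro mult_right_mono) auto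
    finally show ?thesis by (simp add: field_simps)
  qed
  have int_g: "(\<lambda>t. g t * character (- n) t * of_real ((norm (F t))\<^sup>2)) integrable_on torus_box"
    unfolding torus_box_def
    by (intro integrable_continuous continuous_intros continuous_on_subset[OF g]
        continuous_on_subset[OF contF] subset_UNIV)
  have int_c: "((\<lambda>t. c * of_real ((norm (F t))\<^sup>2)) has_integral c * of_real (P * A)) torus_box"
    using has_integral_linear[OF intF bounded_linear_of_real] by (intro has_integral_mult_right) (simp add: o_def)
  have "norm (integral torus_box (\<lambda>t. g t * character (- n) t * of_real ((norm (F t))\<^sup>2) - c * of_real ((norm (F t))\<^sup>2)))
      \<le> integral torus_box (\<lambda>t. 1 / 4 * (norm (F t))\<^sup>2 + R * (\<Sum>i\<in>UNIV. (norm (cis ((t - u) $ i) - 1))\<^sup>2 * (norm (F t))\<^sup>2))"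
  proof (rule integral_norm_bound_integral)
    show "(\<lambda>t. g t * character (- n) t * of_real ((norm (F t))\<^sup>2) - c * of_real ((norm (F t))\<^sup>2)) integrable_on torus_box"
      using int_g int_c by (intro integrable_diff) (auto simp: integrable_on_def)
    show "(\<lambda>t. 1 / 4 * (norm (F t))\<^sup>2 + R * (\<Sum>i\<in>UNIV. (norm (cis ((t - u) $ i) - 1))\<^sup>2 * (norm (F t))\<^sup>2)) integrable_on torus_box"
      using bound by (auto simp: integrable_on_def)
  next
    fix t
    have "norm (g t * character (- n) t * of_real ((norm (F t))\<^sup>2) - c * of_real ((norm (F t))\<^sup>2))
        = norm (g t * character (- n) t - c) * (norm (F t))\<^sup>2"
      by (simp add: norm_mult norm_power flip: left_diff_distrib)
    also have "\<dots> \<le> (1 / 4 + R * (\<Sum>i\<in>UNIV. (norm (cis ((t - u) $ i) - 1))\<^sup>2)) * (norm (F t))\<^sup>2"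
      by (intro mult_right_mono near) auto
    finally show "norm (g t * character (- n) t * of_real ((norm (F t))\<^sup>2) - c * of_real ((norm (F t))\<^sup>2))
       \<le> 1 / 4 * (norm (F t))\<^sup>2 + R * (\<Sum>i\<in>UNIV. (norm (cis ((t - u) $ i) - 1))\<^sup>2 * (norm (F t))\<^sup>2)"
      by (simp add: distrib_right sum_distrib_right mult.assoc)
  qed
  also have "\<dots> \<le> P * (A / 2)" using val by (simp only: integral_unique[OF bound])
  finally have "norm (integral torus_box (\<lambda>t. g t * character (- n) t * of_real ((norm (F t))\<^sup>2)) - c * of_real (P * A))
      \<le> P * (A / 2)"
    using integral_diff[OF int_g has_integral_integrable[OF int_c]] integral_unique[OF int_c] by (simp only:)
  \<comment> \<open>The constant \<open>c\<close> alone would give an integral of modulus P A; the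
    error takes away at most half of it.\<close>
  moreover have "norm (c * of_real (P * A)) = P * A" using c P A by (simp add: norm_mult)
  moreover have "norm (c * complex_of_real (P * A)) - norm (integral torus_box (\<lambda>t. g t * character (- n) t * of_real ((norm (F t))\<^sup>2)))
      \<le> norm (integral torus_box (\<lambda>t. g t * character (- n) t * of_real ((norm (F t))\<^sup>2)) - c * of_real (P * A))"
    by (subst norm_minus_commute) (rule norm_triangle_ineq2)
  moreover have "P * A = P * (A / 2) + P * (A / 2)" by simp
  ultimately have "P * (A / 2) \<le> norm (integral torus_box (\<lambda>t. g t * character (- n) t * of_real ((norm (F t))\<^sup>2)))"
    by linarith
  also have "\<dots> \<le> P * (\<Sum>k\<in>S. \<Sum>l\<in>S. a k * a l * norm (fourier_coeff g (n - k + l)))"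
    unfolding F_def P_def by (rule norm_integral_trig_kernel_le[OF g S(1,2)])
  finally show ?thesis using P by (simp add: A_def)
qed

subsection \<open>Taylor estimates from partial derivatives\<close>

lemma has_partial_deriv_gradient:
  assumes "\<And>i x. \<exists>D. has_partial_deriv \<phi> i x D"
  shows "has_partial_deriv \<phi> i x (gradient \<phi> x $ i)"
proof -
  obtain D where D: "has_partial_deriv \<phi> i x D" using assms by blast
  then have "(THE D. has_partial_deriv \<phi> i x D) = D"
    unfolding has_partial_deriv_def by (blast intro: DERIV_unique)
  with D show ?thesis by (simp add: gradient_def)
qed

text \<open>Only partial derivatives are given, so the path from \<open>u\<close> to
  \<open>u + s\<close> changes one coordinate at a time. On each edge the mean value inequality
  costs at most |s| e, and there are m edges.\<close>

lemma partial_derivs_taylor: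
  fixes \<phi> :: "real^'m \<Rightarrow> real" and D :: "real^'m \<Rightarrow> real^'m"
  assumes pd: "\<And>i x. has_partial_deriv \<phi> i x (D x $ i)"
    and osc: "\<And>i x y. dist x y \<le> norm s \<Longrightarrow> \<bar>D x $ i - D y $ i\<bar> \<le> e"
  shows "\<bar>\<phi> (u + s) - \<phi> u - D u \<bullet> s\<bar> \<le> CARD('m) * (norm s * e)"
proof -
  define v where "v = (\<lambda>A. \<Sum>i\<in>A. s $ i *\<^sub>R (axis i 1 :: real^'m))"
  have v_nth: "v A $ j = (if j \<in> A then s $ j else 0)" for A j
  proof -
    have "v A $ j = (\<Sum>i\<in>A. if i = j then s $ j else 0)"
      unfolding v_def by (auto simp: axis_def if_distrib cong: if_cong intro!: sum.cong)
    then show ?thesis by simp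
  qed
  have "\<bar>\<phi> (u + v A) - \<phi> u - (\<Sum>i\<in>A. D u $ i * s $ i)\<bar> \<le> card A * (norm s * e)" if "finite A" for A
    using that
  proof induction
    case (insert j A)
    \<comment> \<open>Subtracting the linear term leaves a function whose derivative is an
      oscillation of the partial derivative, hence at most \<open>e\<close>.\<close>
    define f where "f = (\<lambda>\<tau>. \<phi> (u + v A + \<tau> *\<^sub>R axis j 1) - D u $ j * \<tau>)"
    have "norm (f (s $ j) - f 0) \<le> e * norm (s $ j - 0)"
    proof (rule field_differentiable_bound)
      fix \<tau> assume \<tau>: "\<tau> \<in> closed_segment 0 (s $ j)"
      define x where "x = u + v A + \<tau> *\<^sub>R axis j 1"
      have "((\<lambda>h. \<phi> (x + h *\<^sub>R axis j 1)) has_real_derivative D x $ j) (at 0)"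
        using pd[of j x] by (simp add: has_partial_deriv_def)
      then have "((\<lambda>h. \<phi> (u + v A + h *\<^sub>R axis j 1)) has_real_derivative D x $ j) (at \<tau>)"
        unfolding x_def by (subst DERIV_shift[of _ _ 0 \<tau>, simplified]) (simp add: algebra_simps)
      then show "(f has_field_derivative D x $ j - D u $ j) (at \<tau> within closed_segment 0 (s $ j))"
        unfolding f_def by (auto intro!: derivative_eq_intros intro: DERIV_subset)
      \<comment> \<open>Every coordinate of x - u is bounded in modulus by that of \<open>s\<close>,
        so the edge stays within the distance that \<open>osc\<close> controls.\<close>
      have "norm (x - u) \<le> norm s"
      proof (rule norm_le_componentwise_cart)
        fix i
        have "\<bar>\<tau>\<bar> \<le> \<bar>s $ j\<bar>" using \<tau> by (auto simp: closed_segment_eq_real_ivl split: if_splits)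
        then show "norm ((x - u) $ i) \<le> norm (s $ i)"
          using insert.hyps by (auto simp: x_def v_nth axis_def)
      qed
      then show "norm (D x $ j - D u $ j) \<le> e"
        using osc[of x u j] by (simp add: dist_norm)
    qed auto
    also have "\<dots> \<le> e * norm s"
    proof (rule mult_left_mono)
      show "0 \<le> e" using osc[of u u j] by simp
    qed (use component_le_norm_cart[of s j] in simp)
    finally have "\<bar>f (s $ j) - f 0\<bar> \<le> norm s * e" by (simp add: mult.commute)
    moreover have "f (s $ j) - f 0 = \<phi> (u + v (insert j A)) - \<phi> (u + v A) - D u $ j * s $ j"
      using insert.hyps by (simp add: f_def v_def add_ac)
    ultimately show ?case using insert by (simp add: distrib_right)
  qed (simp add: v_def)
  from this[of UNIV] have "\<bar>\<phi> (u + v UNIV) - \<phi> u - D u \<bullet> s\<bar> \<le> CARD('m) * (norm s * e)"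
    by (simp add: inner_vec_def)
  moreover have "v UNIV = s" by (simp add: vec_eq_iff v_nth)
  ultimately show ?thesis by simp
qed

text \<open>An oscillation bound at the single scale \<open>r\<close> already makes the increment of
  \<phi> at most |s| L, by the Taylor estimate and Cauchy-Schwarz.\<close>

lemma continuous_on_partial_derivs:
  fixes \<phi> :: "real^'m \<Rightarrow> real" and D :: "real^'m \<Rightarrow> real^'m"
  assumes pd: "\<And>i x. has_partial_deriv \<phi> i x (D x $ i)"
    and r: "r > 0" and osc: "\<And>i x y. dist x y \<le> r \<Longrightarrow> \<bar>D x $ i - D y $ i\<bar> \<le> e"
  shows "continuous_on UNIV \<phi>"
proof -
  have "isCont \<phi> u" for u
  proof -
    define L where "L = norm (D u) + CARD('m) * e"
    have "\<forall>\<^sub>F s in at 0. norm (\<phi> (u + s) - \<phi> u) \<le> norm s * L"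
      unfolding eventually_at
    proof (intro exI[of _ r] conjI ballI impI r)
      fix s :: "real^'m" assume "s \<noteq> 0 \<and> dist s 0 < r"
      then have "norm s \<le> r" by simp
      then have "\<bar>\<phi> (u + s) - \<phi> u - D u \<bullet> s\<bar> \<le> CARD('m) * (norm s * e)"
        using osc by (intro partial_derivs_taylor pd) auto
      moreover have "\<bar>D u \<bullet> s\<bar> \<le> norm (D u) * norm s" by (rule Cauchy_Schwarz_ineq2)
      ultimately show "norm (\<phi> (u + s) - \<phi> u) \<le> norm s * L"
        by (simp add: L_def algebra_simps abs_if split: if_splits)
    qed
    moreover have "((\<lambda>s::real^'m. norm s * L) \<longlongrightarrow> 0) (at 0)"
      by (auto intro!: tendsto_eq_intros)
    ultimately have "((\<lambda>s. \<phi> (u + s) - \<phi> u) \<longlongrightarrow> 0) (at 0)"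
      by (rule Lim_null_comparison)
    then have "(\<lambda>s. \<phi> (u + s)) \<midarrow>0\<rightarrow> \<phi> u" by (simp add: LIM_zero_iff)
    then show ?thesis by (simp add: isCont_def LIM_offset_zero_iff)
  qed
  then show ?thesis by (simp add: continuous_at_imp_continuous_on)
qed

section \<open>Periodicity and a uniform modulus for the gradient\<close>

lemma periodic_torus_int:
  fixes f :: "real^'m \<Rightarrow> 'b" and z :: "'m \<Rightarrow> int"
  assumes "periodic_torus f"
  shows "f (x + (\<chi> i. 2 * pi * of_int (z i))) = f x"
proof -
  have nat: "f (y + (2 * pi * of_nat n) *\<^sub>R axis i 1) = f y" for n y i
  proof (induction n)
    case (Suc n)
    have "f (y + (2 * pi * of_nat (Suc n)) *\<^sub>R axis i 1) =
          f ((y + (2 * pi * of_nat n) *\<^sub>R axis i 1) + (2 * pi) *\<^sub>R axis i 1)"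
      by (simp add: algebra_simps)
    also have "\<dots> = f (y + (2 * pi * of_nat n) *\<^sub>R axis i 1)"
      using assms unfolding periodic_torus_def by blast
    finally show ?case using Suc by simp
  qed simp
  have int: "f (y + (2 * pi * of_int k) *\<^sub>R axis i 1) = f y" for k y i
  proof (cases k rule: int_cases2)
    case (nonneg n)
    then show ?thesis using nat by simp
  next
    case (nonpos n)
    then show ?thesis using nat[of "y + (2 * pi * of_int k) *\<^sub>R axis i 1" n i] by (simp add: algebra_simps)
  qed
  have "f (x + (\<Sum>i\<in>A. (2 * pi * of_int (z i)) *\<^sub>R axis i 1)) = f x" if "finite A" for A
    using that
  proof (induction A)
    case (insert j A)
    then show ?case
      using int[of "x + (\<Sum>i\<in>A. (2 * pi * of_int (z i)) *\<^sub>R axis i 1)" "z j" j] by (simp add: add_ac)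
  qed simp
  from this[of UNIV] show ?thesis
    using basis_expansion[of "\<chi> i. 2 * pi * of_int (z i)"] by (simp add: scalar_mult_eq_scaleR)
qed

lemma Lip_omegaD:
  assumes "Lip_omega \<omega> UNIV g"
  shows "\<exists>C. \<forall>\<^sub>F \<delta> in at_right 0. \<forall>x y. dist x y \<le> \<delta> \<longrightarrow> \<bar>g x - g y\<bar> \<le> C * \<bar>\<omega> \<delta>\<bar>"
proof -
  from assms obtain C where C: "\<forall>\<^sub>F \<delta> in at_right 0. modulus_cont UNIV g \<delta> \<le> ereal (C * \<bar>\<omega> \<delta>\<bar>)"
    by (auto simp: Lip_omega_def)
  show ?thesis
  proof (intro exI, use C in \<open>rule eventually_mono\<close>, intro allI impI)
    fix \<delta> :: real and x y :: 'a
    assume le: "modulus_cont UNIV g \<delta> \<le> ereal (C * \<bar>\<omega> \<delta>\<bar>)" and "dist x y \<le> \<delta>"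
    then have "ereal \<bar>g x - g y\<bar> \<le> modulus_cont UNIV g \<delta>"
      unfolding modulus_cont_def by (intro Sup_upper) auto
    with le have "ereal \<bar>g x - g y\<bar> \<le> ereal (C * \<bar>\<omega> \<delta>\<bar>)" by (rule order_trans[rotated])
    then show "\<bar>g x - g y\<bar> \<le> C * \<bar>\<omega> \<delta>\<bar>" by simp
  qed
qed

lemma C1_omega_gradientE:
  fixes \<phi> :: "real^'m \<Rightarrow> real"
  assumes "C1_omega \<omega> \<phi>"
  obtains C d where "C > 0" "d > 0" "\<And>i x. has_partial_deriv \<phi> i x (gradient \<phi> x $ i)"
    "\<And>\<delta> i x y. 0 < \<delta> \<Longrightarrow> \<delta> < d \<Longrightarrow> dist x y \<le> \<delta> \<Longrightarrow>
        \<bar>gradient \<phi> x $ i - gradient \<phi> y $ i\<bar> \<le> C * \<bar>\<omega> \<delta>\<bar>"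
proof -
  have lip: "Lip_omega \<omega> UNIV (\<lambda>x. gradient \<phi> x $ i)" for i
    using assms by (simp add: C1_omega_def gradient_def)
  have "\<forall>i. \<exists>C. \<forall>\<^sub>F \<delta> in at_right 0. \<forall>x y. dist x y \<le> \<delta> \<longrightarrow>
      \<bar>gradient \<phi> x $ i - gradient \<phi> y $ i\<bar> \<le> C * \<bar>\<omega> \<delta>\<bar>"
    by (intro allI Lip_omegaD lip)
  from choice[OF this] obtain C where C: "\<forall>i. \<forall>\<^sub>F \<delta> in at_right 0. \<forall>x y. dist x y \<le> \<delta> \<longrightarrow>
      \<bar>gradient \<phi> x $ i - gradient \<phi> y $ i\<bar> \<le> C i * \<bar>\<omega> \<delta>\<bar>" ..
  have "\<forall>\<^sub>F \<delta> in at_right 0. \<forall>i x y. dist x y \<le> \<delta> \<longrightarrow>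
      \<bar>gradient \<phi> x $ i - gradient \<phi> y $ i\<bar> \<le> C i * \<bar>\<omega> \<delta>\<bar>"
    by (rule eventually_all_finite[OF C[rule_format]])
  then obtain d where d: "d > 0" "\<And>\<delta> i x y. 0 < \<delta> \<Longrightarrow> \<delta> < d \<Longrightarrow> dist x y \<le> \<delta> \<Longrightarrow>
      \<bar>gradient \<phi> x $ i - gradient \<phi> y $ i\<bar> \<le> C i * \<bar>\<omega> \<delta>\<bar>"
    unfolding eventually_at_right_field by blast
  \<comment> \<open>The sum dominates every \<open>C i\<close>; the added 1 makes the constant
    strictly positive, so that it can serve as a divisor.\<close>
  define C' where "C' = 1 + (\<Sum>i\<in>UNIV. \<bar>C i\<bar>)"
  have le: "C i \<le> C'" for i
    using member_le_sum[of i UNIV "\<lambda>i. \<bar>C i\<bar>"] by (simp add: C'_def)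
  show thesis
  proof (rule that[of C' d])
    show "C' > 0" unfolding C'_def by (simp add: add_pos_nonneg sum_nonneg)
    show "has_partial_deriv \<phi> i x (gradient \<phi> x $ i)" for i x
      using assms by (intro has_partial_deriv_gradient) (auto simp: C1_omega_def)
    fix \<delta> :: real and i and x y :: "real^'m"
    assume "0 < \<delta>" "\<delta> < d" "dist x y \<le> \<delta>"
    then show "\<bar>gradient \<phi> x $ i - gradient \<phi> y $ i\<bar> \<le> C' * \<bar>\<omega> \<delta>\<bar>"
      using d(2)[of \<delta> x y i] le[of i] by (meson abs_ge_zero mult_right_mono order_trans)
  qed (rule d(1))
qed

subsection \<open>The lower bound\<close>

lemma periodic_torus_character: "periodic_torus (character k)"
proof -
  have "(\<Sum>j\<in>UNIV. of_int (k $ j) * (2 * pi * axis i (1::real) $ j)) = 2 * pi * of_int (k $ i)" for i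
    by (simp add: axis_def if_distrib cong: if_cong)
  then have "(\<Sum>j\<in>UNIV. of_int (k $ j) * (x + (2 * pi) *\<^sub>R axis i 1) $ j)
      = (\<Sum>j\<in>UNIV. of_int (k $ j) * x $ j) + 2 * pi * of_int (k $ i)" for x i
    by (simp add: distrib_left sum.distrib)
  then show ?thesis
    by (simp add: periodic_torus_def character_def flip: cis_mult)
qed

text \<open>Rounding each coordinate of t - u to whole periods. The bound pi keeps the half-angles
  in the range where the sine is comparable with its argument.\<close>

lemma torus_translate_to_box:
  fixes t u :: "real^'m"
  obtains z :: "'m \<Rightarrow> int" and s where "t = u + s + (\<chi> i. 2 * pi * of_int (z i))" "\<And>i. \<bar>s $ i\<bar> \<le> pi"
proof
  define z where "z = (\<lambda>i. round ((t - u) $ i / (2 * pi)))"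
  define s where "s = t - u - (\<chi> i. 2 * pi * of_int (z i))"
  show "t = u + s + (\<chi> i. 2 * pi * of_int (z i))" by (simp add: s_def)
  fix i
  have cancel: "2 * pi * (x - y / (2 * pi)) = 2 * pi * x - y" for x y :: real
    by (simp add: field_simps)
  have "\<bar>of_int (z i) - (t - u) $ i / (2 * pi)\<bar> \<le> 1 / 2"
    unfolding z_def by (rule of_int_round_abs_le)
  then have "2 * pi * \<bar>of_int (z i) - (t - u) $ i / (2 * pi)\<bar> \<le> 2 * pi * (1 / 2)"
    by (intro mult_left_mono) auto
  also have "2 * pi * \<bar>of_int (z i) - (t - u) $ i / (2 * pi)\<bar>
      = \<bar>2 * pi * (of_int (z i) - (t - u) $ i / (2 * pi))\<bar>" by (simp add: abs_mult)
  also have "2 * pi * (of_int (z i) - (t - u) $ i / (2 * pi)) = - (s $ i)"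
    by (simp only: cancel) (simp add: s_def)
  finally show "\<bar>s $ i\<bar> \<le> pi" by simp
qed

text \<open>Near \<open>u\<close> modulo periods the linear part of the phase is cancelled up to
  rounding, which gives the 1/4. Away from \<open>u\<close> the left side is at most 2, and the
  second term is large enough to absorb it.\<close>

lemma cis_phase_near_constant:
  fixes \<phi> :: "real^'m \<Rightarrow> real" and D :: "real^'m" and l r :: real
  defines "n \<equiv> \<chi> i. round (l * D $ i)"
  assumes per: "periodic_torus \<phi>" and r: "0 < r" "CARD('m) * r \<le> 1 / 4"
    and taylor: "\<And>s. norm s \<le> r \<Longrightarrow> \<bar>l\<bar> * \<bar>\<phi> (u + s) - \<phi> u - D \<bullet> s\<bar> \<le> 1 / 8"
  shows "norm (cis (l * \<phi> t) * character (- n) t - cis (l * \<phi> u) * character (- n) u)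
    \<le> 1 / 4 + 18 / r\<^sup>2 * (\<Sum>i\<in>UNIV. (norm (cis ((t - u) $ i) - 1))\<^sup>2)"
proof -
  obtain z s where t: "t = u + s + (\<chi> i. 2 * pi * of_int (z i))" and s: "\<And>i. \<bar>s $ i\<bar> \<le> pi"
    using torus_translate_to_box by blast
  define c where "c = cis (l * \<phi> u) * character (- n) u"
  have c: "norm c = 1" by (simp add: c_def norm_mult)
  define \<theta> where "\<theta> = l * (\<phi> (u + s) - \<phi> u) - (\<Sum>i\<in>UNIV. of_int (n $ i) * s $ i)"
  have "cis (l * \<phi> t) * character (- n) t = cis (l * \<phi> (u + s)) * character (- n) (u + s)"
    unfolding t periodic_torus_int[OF per] periodic_torus_int[OF periodic_torus_character] ..
  also have "\<dots> = c * cis \<theta>"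
    by (simp add: c_def character_def cis_mult \<theta>_def sum_negf sum.distrib sum_subtractf algebra_simps)
  finally have "norm (cis (l * \<phi> t) * character (- n) t - c) = norm (c * (cis \<theta> - 1))"
    by (simp add: right_diff_distrib)
  then have eq: "norm (cis (l * \<phi> t) * character (- n) t - c) = norm (cis \<theta> - 1)"
    by (simp add: norm_mult c)
  have cis_s: "cis ((t - u) $ i) = cis (s $ i)" for i
    using periodic_torus_int[OF periodic_torus_character, of "axis i 1" s z]
    by (simp add: t character_axis)
  have "norm (cis \<theta> - 1) \<le> 1 / 4 + 18 / r\<^sup>2 * (\<Sum>i\<in>UNIV. (norm (cis (s $ i) - 1))\<^sup>2)"
  proof (cases "norm s \<le> r")
    case True
    \<comment> \<open>The phase splits into the Taylor error, at most 1/8, and the error of rounding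
      the frequency, at most m r / 2 <= 1/8.\<close>
    have "\<theta> = l * (\<phi> (u + s) - \<phi> u - D \<bullet> s) + (\<Sum>i\<in>UNIV. (l * D $ i - of_int (n $ i)) * s $ i)"
      by (simp add: \<theta>_def inner_vec_def algebra_simps sum_subtractf sum_distrib_left)
    moreover have "\<bar>l * (\<phi> (u + s) - \<phi> u - D \<bullet> s)\<bar> \<le> 1 / 8"
      using taylor[OF True] by (simp add: abs_mult)
    moreover have "\<bar>\<Sum>i\<in>UNIV. (l * D $ i - of_int (n $ i)) * s $ i\<bar> \<le> (\<Sum>i\<in>(UNIV::'m set). 1 / 2 * r)"
    proof (intro order_trans[OF sum_abs] sum_mono)
      fix i
      have "\<bar>l * D $ i - of_int (n $ i)\<bar> \<le> 1 / 2"
        unfolding n_def using of_int_round_abs_le[of "l * D $ i"] by (simp add: abs_minus_commute)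
      moreover have "\<bar>s $ i\<bar> \<le> r" using True component_le_norm_cart[of s i] by linarith
      ultimately show "\<bar>(l * D $ i - of_int (n $ i)) * s $ i\<bar> \<le> 1 / 2 * r"
        unfolding abs_mult by (intro mult_mono) auto
    qed
    ultimately have "\<bar>\<theta>\<bar> \<le> 1 / 8 + (\<Sum>i\<in>(UNIV::'m set). 1 / 2 * r)" by linarith
    also have "\<dots> = 1 / 8 + CARD('m) * r / 2" by simp
    also have "\<dots> \<le> 1 / 4" using r(2) by linarith
    finally have "\<bar>\<theta>\<bar> \<le> 1 / 4" .
    moreover have "norm (cis \<theta> - 1) \<le> \<bar>\<theta>\<bar>"
      unfolding norm_cis_minus_1 using abs_sin_x_le_abs_x[of "\<theta> / 2"] by simp
    moreover have "0 \<le> 18 / r\<^sup>2 * (\<Sum>i\<in>UNIV. (norm (cis (s $ i) - 1))\<^sup>2)"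
      by (intro mult_nonneg_nonneg sum_nonneg) auto
    ultimately show ?thesis by linarith
  next
    case False
    have "r\<^sup>2 \<le> (norm s)\<^sup>2" using False r(1) by (intro power_mono) auto
    also have "\<dots> = (\<Sum>i\<in>UNIV. (s $ i)\<^sup>2)"
      by (simp add: norm_vec_def L2_set_def sum_nonneg)
    also have "\<dots> \<le> (\<Sum>i\<in>UNIV. 9 * (norm (cis (s $ i) - 1))\<^sup>2)"
    proof (rule sum_mono)
      fix i
      have "\<bar>s $ i / 2\<bar> / 3 \<le> \<bar>sin (s $ i / 2)\<bar>"
        using s[of i] pi_less_4 by (intro sin_ge_third) simp
      then have "\<bar>s $ i\<bar> \<le> 3 * norm (cis (s $ i) - 1)"
        unfolding norm_cis_minus_1 by simp
      then have "\<bar>s $ i\<bar>\<^sup>2 \<le> (3 * norm (cis (s $ i) - 1))\<^sup>2" by (intro power_mono) auto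
      then show "(s $ i)\<^sup>2 \<le> 9 * (norm (cis (s $ i) - 1))\<^sup>2" by (simp add: power_mult_distrib)
    qed
    finally have "r\<^sup>2 \<le> 9 * (\<Sum>i\<in>UNIV. (norm (cis (s $ i) - 1))\<^sup>2)"
      by (simp add: sum_distrib_left)
    \<comment> \<open>The factor 18 is 2 times 9, where 9 comes from squaring |s_i| <= 3 |cis s_i -
      1|.\<close>
    then have "2 \<le> 18 / r\<^sup>2 * (\<Sum>i\<in>UNIV. (norm (cis (s $ i) - 1))\<^sup>2)"
      using r(1) by (simp add: field_simps)
    moreover have "norm (cis \<theta> - 1) \<le> 2"
      using norm_triangle_ineq4[of "cis \<theta>" 1] by simp
    ultimately show ?thesis by linarith
  qed
  then show ?thesis unfolding cis_s eq[unfolded c_def] .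
qed

text \<open>If l x rounds to n, then x lies in the cube of side 1 / |l| centred at n / l; these
  cubes cover \<open>X\<close>, and their measures add up to the bound.\<close>

lemma emeasure_le_card_rounded:
  fixes X :: "(real^'m) set" and l :: real
  defines "B \<equiv> (\<lambda>x. \<chi> i. round (l * x $ i)) ` X"
  assumes "l \<noteq> 0" "finite B"
  shows "emeasure lebesgue X \<le> ennreal (card B * (1 / \<bar>l\<bar>) ^ CARD('m))"
proof -
  define Q where "Q = (\<lambda>n::int^'m. cbox (\<chi> i. n $ i / l - 1 / (2 * \<bar>l\<bar>)) (\<chi> i. n $ i / l + 1 / (2 * \<bar>l\<bar>)))"
  have Qm: "Q n \<in> sets lebesgue" for n by (simp add: Q_def)
  have eQ: "emeasure lebesgue (Q n) = ennreal ((1 / \<bar>l\<bar>) ^ CARD('m))" for n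
  proof -
    have "Q n \<noteq> {}" unfolding Q_def by (simp add: interval_ne_empty_cart)
    then have "measure lborel (Q n) = (1 / \<bar>l\<bar>) ^ CARD('m)"
      unfolding Q_def by (simp add: content_cbox_cart)
    moreover have "emeasure lebesgue (Q n) = ennreal (measure lborel (Q n))"
      unfolding Q_def by (simp add: emeasure_eq_ennreal_measure emeasure_lborel_cbox_eq)
    ultimately show ?thesis by simp
  qed
  have "X \<subseteq> (\<Union>n\<in>B. Q n)"
  proof
    fix x assume "x \<in> X"
    define n where "n = (\<chi> i. round (l * x $ i))"
    have "x \<in> Q n"
    proof -
      have "\<bar>of_int (n $ i) / l - x $ i\<bar> \<le> 1 / (2 * \<bar>l\<bar>)" for i
      proof -
        have "\<bar>of_int (n $ i) - l * x $ i\<bar> / \<bar>l\<bar> \<le> (1 / 2) / \<bar>l\<bar>"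
          unfolding n_def using of_int_round_abs_le[of "l * x $ i"] by (intro divide_right_mono) auto
        moreover have "of_int (n $ i) / l - x $ i = (of_int (n $ i) - l * x $ i) / l"
          using assms by (simp add: field_simps)
        ultimately show ?thesis by (simp add: abs_divide)
      qed
      note this[unfolded abs_le_iff]
      then show ?thesis by (simp add: Q_def mem_box_cart algebra_simps)
    qed
    moreover have "n \<in> B" using \<open>x \<in> X\<close> by (auto simp: B_def n_def)
    ultimately show "x \<in> (\<Union>n\<in>B. Q n)" by blast
  qed
  then have "emeasure lebesgue X \<le> emeasure lebesgue (\<Union>n\<in>B. Q n)"
    using assms(3) Qm by (intro emeasure_mono sets.finite_UN)
  also have "\<dots> \<le> (\<Sum>n\<in>B. emeasure lebesgue (Q n))"
    using assms(3) Qm by (intro emeasure_subadditive_finite) auto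
  also have "\<dots> = ennreal (card B * (1 / \<bar>l\<bar>) ^ CARD('m))"
    by (simp add: eQ ennreal_mult ennreal_of_nat_eq_real_of_nat)
  finally show ?thesis .
qed

text \<open>The set \<open>B\<close> of rounded frequencies is counted twice: from above through the
  l^p sum, with a kernel of degree of order 1 / r, and from below through the measure of the range
  of \<open>D\<close>.\<close>

lemma Ap_norm_cis_lower_bound:
  fixes \<phi> :: "real^'m \<Rightarrow> real" and D :: "real^'m \<Rightarrow> real^'m" and r :: real
  defines "m \<equiv> CARD('m)"
  assumes p: "1 \<le> p" and l: "l \<in> Lambda_set \<phi> p" "l \<noteq> 0"
    and per: "periodic_torus \<phi>" and cont: "continuous_on UNIV \<phi>"
    and r: "0 < r" "m * r \<le> 1 / 4"
    and taylor: "\<And>u s. norm s \<le> r \<Longrightarrow> \<bar>l\<bar> * \<bar>\<phi> (u + s) - \<phi> u - D u \<bullet> s\<bar> \<le> 1 / 8"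
    and \<mu>: "0 < \<mu>" "ennreal \<mu> \<le> emeasure lebesgue (range D)"
  shows "\<mu> powr (1 / p) / (2 * (90 * real m * (2 * real m) ^ m) ^ m) * (\<bar>l\<bar> powr (1 / p) * r) ^ m
       \<le> Ap_norm p (\<lambda>t. cis (l * \<phi> t))"
proof -
  define g where "g = (\<lambda>t. cis (l * \<phi> t))"
  define b where "b = (\<lambda>k. norm (fourier_coeff g k))"
  define I where "I = (\<Sum>\<^sub>\<infinity>k. b k powr p)"
  \<comment> \<open>With q = (2 m)^m, the kernel condition \<open>R\<close> amounts to 72 q <= m (r
    N)^2. It holds once r N >= 9 q = K, since 81 q^2 >= 72 q.\<close>
  define K :: real where "K = 9 * (2 * real m) ^ m"
  define N where "N = nat \<lceil>K / r\<rceil>"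
  define B where "B = (\<lambda>x. \<chi> i. round (l * x $ i)) ` range D"
  have m: "m \<ge> 1" by (simp add: m_def Suc_leI)
  have K1: "K \<ge> 9"
  proof -
    have "1 \<le> (2 * real m) ^ m" using m by (intro one_le_power) auto
    then show ?thesis by (simp add: K_def)
  qed
  have r1: "r \<le> 1"
  proof -
    have "1 * r \<le> m * r" using m r(1) by (intro mult_right_mono) auto
    then show ?thesis using r(2) by simp
  qed
  have Kr: "K / r \<ge> 1" using K1 r(1) r1 by (simp add: field_simps)
  have N_ge: "K / r \<le> N" unfolding N_def using real_nat_ceiling_ge by blast
  have N_le: "N \<le> 2 * K / r"
  proof -
    have "real N \<le> K / r + 1" unfolding N_def using Kr of_int_ceiling_le_add_one[of "K / r"] by simp
    then show ?thesis using Kr by simp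
  qed
  have N1: "N \<ge> 1" using N_ge Kr by linarith
  obtain S and a :: "int^'m \<Rightarrow> real" where S:
    "finite S" "\<And>k. 0 \<le> a k" "\<And>k. k \<notin> S \<Longrightarrow> a k = 0"
    "\<And>k i. k \<notin> S \<Longrightarrow> a (k - axis i 1) = 0"
    "0 < (\<Sum>k\<in>S. (a k)\<^sup>2)" "real (card S) \<le> (5 * real m * real N) ^ m"
    "\<And>i. (\<Sum>k\<in>S. (a k - a (k - axis i 1))\<^sup>2) \<le> (2 * real m) ^ m / (real m * real N)\<^sup>2 * (\<Sum>k\<in>S. (a k)\<^sup>2)"
    by (rule kernel_coeffs_exist[OF N1, where 'm='m, folded m_def]) (rule that; assumption)
  define A where "A = (\<Sum>k\<in>S. (a k)\<^sup>2)"
  have A: "A > 0" using S by (simp add: A_def)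
  have R: "18 / r\<^sup>2 * CARD('m) * ((2 * real m) ^ m / (real m * real N)\<^sup>2) \<le> 1 / 4"
  proof -
    define q where "q = (2 * real m) ^ m"
    have q: "q \<ge> 1" unfolding q_def using m by (intro one_le_power) auto
    have "9 * q = K" by (simp add: K_def q_def)
    then have "9 * q \<le> r * N" using N_ge r(1) by (simp add: field_simps)
    then have "(9 * q)\<^sup>2 \<le> (r * N)\<^sup>2" using q by (intro power_mono) auto
    moreover have "72 * q \<le> (9 * q)\<^sup>2"
    proof -
      have "72 * q \<le> 81 * (q * 1)" using q by simp
      also have "\<dots> \<le> 81 * (q * q)" using q by (intro mult_left_mono) auto
      finally show ?thesis by (simp add: power2_eq_square)
    qed
    ultimately have "72 * q \<le> (r * N)\<^sup>2" by linarith
    also have "\<dots> \<le> m * (r * N)\<^sup>2" using m mult_right_mono[of 1 "real m" "(r * N)\<^sup>2"] by simp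
    finally have le: "72 * q / (m * (r * N)\<^sup>2) \<le> 1"
      using m N1 r(1) by (simp add: divide_le_eq)
    have "18 / r\<^sup>2 * CARD('m) * (q / (real m * real N)\<^sup>2) = 72 * q / (m * (r * N)\<^sup>2) / 4"
      using m N1 r(1) by (simp add: m_def[symmetric] power2_eq_square field_simps)
    also have "\<dots> \<le> 1 / 4" using le by (rule divide_right_mono) simp
    finally show ?thesis unfolding q_def .
  qed
  have cont_g: "continuous_on UNIV g" unfolding g_def by (intro continuous_intros cont)
  have sum_b: "(\<lambda>k. b k powr p) summable_on UNIV"
    using l(1) by (simp add: Lambda_set_def in_Ap_def b_def g_def)
  have low: "A / 2 \<le> (\<Sum>k\<in>S. \<Sum>l\<in>S. a k * a l * b (n - k + l))" if "n \<in> B" for n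
  proof -
    from that obtain u where n: "n = (\<chi> i. round (l * D u $ i))" by (auto simp: B_def)
    show ?thesis unfolding A_def b_def
    proof (rule fourier_coeff_sum_lower_bound[OF cont_g S(1-4) S(7) _ R])
      show "0 \<le> 18 / r\<^sup>2" by (intro divide_nonneg_nonneg) auto
      show "norm (cis (l * \<phi> u) * character (- n) u) = 1" by (simp add: norm_mult)
      show "norm (g t * character (- n) t - cis (l * \<phi> u) * character (- n) u)
         \<le> 1 / 4 + 18 / r\<^sup>2 * (\<Sum>i\<in>UNIV. (norm (cis ((t - u) $ i) - 1))\<^sup>2)" for t
        unfolding g_def n using per r taylor unfolding m_def by (intro cis_phase_near_constant) auto
    qed
  qed
  have I: "I \<ge> 0" unfolding I_def by (intro infsum_nonneg) auto
  \<comment> \<open>\<open>Y\<close> bounds the total kernel mass divided by A / 2: Cauchy-Schwarz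
    gives (sum of a)^2 <= A card S.\<close>
  define Y where "Y = 2 * (5 * real m * real N) ^ m"
  have Y: "Y \<ge> 0" by (simp add: Y_def)
  have count: "card B' \<le> Y powr p * I" if "B' \<subseteq> B" "finite B'" for B'
  proof -
    have "real (card B') * (A / 2) powr p \<le> ((\<Sum>k\<in>S. a k)\<^sup>2) powr p * I"
      unfolding I_def using S p sum_b low that A
      by (intro count_le_lp_sum) (auto simp: b_def)
    also have "\<dots> \<le> (A / 2 * Y) powr p * I"
    proof (intro mult_right_mono powr_mono2 I)
      have "(\<Sum>k\<in>S. a k)\<^sup>2 \<le> A * card S"
        unfolding A_def by (rule sum_squared_le_sum_of_squares)
      also have "\<dots> \<le> A * (5 * real m * real N) ^ m" using S(6) A by (intro mult_left_mono) auto
      finally show "(\<Sum>k\<in>S. a k)\<^sup>2 \<le> A / 2 * Y" by (simp add: Y_def)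
    qed (use p in auto)
    also have "\<dots> = Y powr p * I * (A / 2) powr p"
      using A Y powr_mult[of "A / 2" Y p] by simp
    finally show ?thesis using A by (simp add: mult_le_cancel_right)
  qed
  \<comment> \<open>The count is bounded uniformly over finite subsets, which forces
    \<open>B\<close> itself to be finite.\<close>
  have "finite B"
  proof (rule finite_if_finite_subsets_card_bdd[THEN conjunct1])
    fix B' assume "B' \<subseteq> B" "finite B'"
    then show "card B' \<le> nat \<lfloor>Y powr p * I\<rfloor>" using count[of B'] by (simp add: le_nat_floor)
  qed
  then have "ennreal \<mu> \<le> ennreal (card B * (1 / \<bar>l\<bar>) ^ m)"
    using \<mu>(2) emeasure_le_card_rounded[of l "range D"] l(2) unfolding B_def m_def by (meson order_trans)
  then have "\<mu> \<le> card B * (1 / \<bar>l\<bar>) ^ m" by (subst (asm) ennreal_le_iff) auto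
  then have "\<mu> * \<bar>l\<bar> ^ m \<le> card B" using l(2) by (simp add: field_simps)
  also have "\<dots> \<le> Y powr p * I" using count \<open>finite B\<close> by blast
  finally have "(\<mu> * \<bar>l\<bar> ^ m) powr (1 / p) \<le> (Y powr p * I) powr (1 / p)"
    using \<mu> p by (intro powr_mono2) auto
  also have "\<dots> = Y * I powr (1 / p)"
    using Y I p powr_mult[of "Y powr p" I "1 / p"] by (simp add: powr_powr)
  also have "\<dots> \<le> 2 * (90 * real m * (2 * real m) ^ m) ^ m / r ^ m * I powr (1 / p)"
  proof (rule mult_right_mono)
    have "(5 * real m * N) ^ m \<le> (5 * real m * (2 * K / r)) ^ m"
      using N_le by (intro power_mono mult_left_mono) auto
    \<comment> \<open>The number 90 is 5 from the size of \<open>S\<close>, times 2 from rounding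
      \<open>N\<close> up, times 9 from \<open>K\<close>.\<close>
    also have "5 * real m * (2 * K / r) = 90 * real m * (2 * real m) ^ m / r" by (simp add: K_def)
    finally show "Y \<le> 2 * (90 * real m * (2 * real m) ^ m) ^ m / r ^ m" by (simp add: Y_def power_divide)
  qed simp
  finally have le: "(\<mu> * \<bar>l\<bar> ^ m) powr (1 / p) \<le> 2 * (90 * real m * (2 * real m) ^ m) ^ m / r ^ m * I powr (1 / p)" .
  have "(\<mu> * \<bar>l\<bar> ^ m) powr (1 / p) = \<mu> powr (1 / p) * (\<bar>l\<bar> ^ m) powr (1 / p)"
    by (rule powr_mult)
  also have "(\<bar>l\<bar> ^ m) powr (1 / p) = (\<bar>l\<bar> powr (1 / p)) ^ m"
    using l(2) by (simp add: powr_realpow[symmetric] powr_powr mult.commute)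
  finally have "\<mu> powr (1 / p) * (\<bar>l\<bar> powr (1 / p)) ^ m \<le> 2 * (90 * real m * (2 * real m) ^ m) ^ m / r ^ m * I powr (1 / p)"
    using le by simp
  moreover have "2 * (90 * real m * (2 * real m) ^ m) ^ m > 0" using m by simp
  ultimately have "\<mu> powr (1 / p) / (2 * (90 * real m * (2 * real m) ^ m) ^ m) * (\<bar>l\<bar> powr (1 / p) * r) ^ m \<le> I powr (1 / p)"
    using r(1) by (simp add: field_simps power_mult_distrib)
  then show ?thesis by (simp add: Ap_norm_def I_def b_def g_def)
qed

section \<open>The modulus and the inverse of \<chi>\<close>

text \<open>If \<omega> vanished at some positive argument, it would vanish at all smaller ones by
  monotonicity. Then \<open>G\<close> would be locally constant, hence constant, and its range a
  null set.\<close>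

lemma modulus_positive:
  fixes G :: "real^'m \<Rightarrow> real^'m"
  assumes mono: "mono_on {0..} \<omega>" and "\<omega> 0 = 0" and d: "d > 0"
    and osc: "\<And>\<delta> i x y. 0 < \<delta> \<Longrightarrow> \<delta> < d \<Longrightarrow> dist x y \<le> \<delta> \<Longrightarrow> \<bar>G x $ i - G y $ i\<bar> \<le> C * \<bar>\<omega> \<delta>\<bar>"
    and G: "emeasure lebesgue (range G) > 0" and \<delta>: "\<delta> > 0"
  shows "\<omega> \<delta> > 0"
proof (rule ccontr)
  assume "\<not> \<omega> \<delta> > 0"
  define \<delta>' where "\<delta>' = min \<delta> (d / 2)"
  have \<delta>': "0 < \<delta>'" "\<delta>' < d" "\<delta>' \<le> \<delta>" using \<delta> d by (auto simp: \<delta>'_def)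
  have "\<omega> \<delta>' \<le> \<omega> \<delta>" "0 \<le> \<omega> \<delta>'"
    using mono_onD[OF mono, of \<delta>' \<delta>] mono_onD[OF mono, of 0 \<delta>'] \<delta>' assms(2) by auto
  with \<open>\<not> \<omega> \<delta> > 0\<close> have "\<omega> \<delta>' = 0" by linarith
  then have loc: "G x = G y" if "dist x y \<le> \<delta>'" for x y
    using osc[OF \<delta>'(1,2) that] by (simp add: vec_eq_iff)
  have "G x = G y" for x y
  proof (rule connected_local_const[of UNIV x y G])
    show "\<forall>a\<in>UNIV. \<forall>\<^sub>F b in at a within UNIV. G a = G b"
      using \<delta>' by (auto simp: eventually_at dist_commute intro!: exI[of _ \<delta>'] loc)
  qed auto
  then have "range G = {G 0}" by auto
  then show False using G by simp
qed

text \<open>This makes \<open>the_inv_into\<close> on the half-line a genuine inverse: strict growth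
  gives injectivity, and the intermediate value theorem gives surjectivity.\<close>

lemma times_modulus_strict_mono_onto:
  assumes cont: "continuous_on {0..} \<omega>" and mono: "mono_on {0..} \<omega>"
    and pos: "\<And>\<delta>. \<delta> > 0 \<Longrightarrow> \<omega> \<delta> > (0::real)"
  defines "\<psi> \<equiv> \<lambda>\<delta>::real. \<delta> * \<omega> \<delta>"
  shows "strict_mono_on {0..} \<psi>" "y \<ge> 0 \<Longrightarrow> y \<in> \<psi> ` {0..}"
proof -
  show "strict_mono_on {0..} \<psi>"
  proof (rule strict_mono_onI)
    fix x y :: real assume xy: "x \<in> {0..}" "y \<in> {0..}" "x < y"
    have "x * \<omega> x \<le> x * \<omega> y" using xy mono_onD[OF mono] by (intro mult_left_mono) auto
    also have "\<dots> < y * \<omega> y" using xy pos[of y] by (intro mult_strict_right_mono) auto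
    finally show "\<psi> x < \<psi> y" by (simp add: \<psi>_def)
  qed
  assume y: "y \<ge> 0"
  \<comment> \<open>Since \<open>X\<close> is at least 1, \<omega>(X) >= \<omega>(1), so X
    \<omega>(X) >= y and \<open>X\<close> is an upper end for the intermediate value
    theorem.\<close>
  define X where "X = max 1 (y / \<omega> 1)"
  have X: "X \<ge> 0" by (simp add: X_def)
  have "y = y / \<omega> 1 * \<omega> 1" using pos[of 1] by simp
  also have "\<dots> \<le> X * \<omega> X"
    using y pos[of 1] mono_onD[OF mono, of 1 X] by (intro mult_mono) (auto simp: X_def)
  finally have "y \<le> \<psi> X" by (simp add: \<psi>_def)
  moreover have "continuous_on {0..X} \<psi>"
    unfolding \<psi>_def by (intro continuous_intros continuous_on_subset[OF cont]) auto
  ultimately obtain x where "0 \<le> x" "\<psi> x = y"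
    using IVT'[of \<psi> 0 y X] y X by (auto simp: \<psi>_def)
  then show "y \<in> \<psi> ` {0..}" by auto
qed

theorem theorem1:
  fixes \<phi> :: "real^'m \<Rightarrow> real" and \<omega> :: "real \<Rightarrow> real" and p :: real
  assumes "1 \<le> p" "p < 2"
    and "continuous_on {0..} \<omega>" "mono_on {0..} \<omega>" "\<omega> 0 = 0"
    and "C1_omega_torus \<omega> \<phi>"
    and "emeasure lebesgue (range (gradient \<phi>)) > 0"
  shows "\<exists>c>0. \<forall>l\<in>Lambda_set \<phi> p. \<bar>l\<bar> \<ge> 1 \<longrightarrow>
           Ap_norm p (\<lambda>t. cis (l * \<phi> t)) \<ge>
           c * (\<bar>l\<bar> powr (1 / p) * the_inv_into {0..} (\<lambda>\<delta>. \<delta> * \<omega> \<delta>) (1 / \<bar>l\<bar>)) ^ CARD('m)"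
proof -
  define m where "m = CARD('m)"
  define \<psi> where "\<psi> = (\<lambda>\<delta>. \<delta> * \<omega> \<delta>)"
  define h where "h = the_inv_into {0..} \<psi>"
  have per: "periodic_torus \<phi>" and C1: "C1_omega \<omega> \<phi>"
    using assms(6) by (auto simp: C1_omega_torus_def)
  obtain C d where C: "C > 0" and d: "d > 0" and pd: "\<And>i x. has_partial_deriv \<phi> i x (gradient \<phi> x $ i)"
    and osc: "\<And>\<delta> i x y. 0 < \<delta> \<Longrightarrow> \<delta> < d \<Longrightarrow> dist x y \<le> \<delta> \<Longrightarrow>
        \<bar>gradient \<phi> x $ i - gradient \<phi> y $ i\<bar> \<le> C * \<bar>\<omega> \<delta>\<bar>"
    using C1_omega_gradientE[OF C1] by metis
  have pos: "\<omega> \<delta> > 0" if "\<delta> > 0" for \<delta>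
    by (rule modulus_positive[OF assms(4,5) d osc assms(7) that])
  have inj: "inj_on \<psi> {0..}" and smono: "strict_mono_on {0..} \<psi>"
    using times_modulus_strict_mono_onto(1)[OF assms(3,4) pos]
    by (auto simp: \<psi>_def intro: strict_mono_on_imp_inj_on)
  have h: "h y \<ge> 0" "\<psi> (h y) = y" if "y \<ge> 0" for y
    using times_modulus_strict_mono_onto(2)[OF assms(3,4) pos that] inj
      the_inv_into_into[of \<psi> "{0..}" y "{0..}"] f_the_inv_into_f[of \<psi> "{0..}" y]
    by (auto simp: h_def \<psi>_def)
  have h1: "h 1 > 0" using h[of 1] by (cases "h 1 = 0") (auto simp: \<psi>_def)
  have m: "m \<ge> 1" by (simp add: m_def Suc_leI)
  have cont: "continuous_on UNIV \<phi>"
    using d by (intro continuous_on_partial_derivs[OF pd, where r = "d / 2" and e = "C * \<bar>\<omega> (d / 2)\<bar>"] osc) auto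
  \<comment> \<open>The four bounds serve in turn for \<omega>(r) <= \<omega>(\<delta>), for r < d,
    for m r <= 1/4, and for a Taylor error of at most 1/8. The second and third use \<delta> <= h 1,
    valid for |l| >= 1.\<close>
  define \<eta> where "\<eta> = Min {1, d / (2 * h 1), 1 / (4 * m * h 1), 1 / (8 * m * C)}"
  have \<eta>: "0 < \<eta>" "\<eta> \<le> 1" "\<eta> \<le> d / (2 * h 1)" "\<eta> \<le> 1 / (4 * m * h 1)" "\<eta> \<le> 1 / (8 * m * C)"
    using d h1 C m by (auto simp: \<eta>_def)
  \<comment> \<open>A finite positive lower bound for the measure is enough, so the value
    \<open>top\<close> is simply replaced by 1.\<close>
  obtain \<mu> where \<mu>: "0 < \<mu>" "ennreal \<mu> \<le> emeasure lebesgue (range (gradient \<phi>))"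
  proof (cases "emeasure lebesgue (range (gradient \<phi>)) = top")
    case True
    then show thesis using that[of 1] by simp
  next
    case False
    then show thesis using that[of "enn2real (emeasure lebesgue (range (gradient \<phi>)))"] assms(7)
      by (simp add: enn2real_positive_iff ennreal_enn2real less_top)
  qed
  define c where "c = \<mu> powr (1 / p) / (2 * (90 * real m * (2 * real m) ^ m) ^ m) * \<eta> ^ m"
  have "c > 0" using \<mu> \<eta> m by (simp add: c_def)
  moreover have "Ap_norm p (\<lambda>t. cis (l * \<phi> t)) \<ge> c * (\<bar>l\<bar> powr (1 / p) * h (1 / \<bar>l\<bar>)) ^ m"
    if l: "l \<in> Lambda_set \<phi> p" "\<bar>l\<bar> \<ge> 1" for l
  proof -
    define \<delta> where "\<delta> = h (1 / \<bar>l\<bar>)"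
    define r where "r = \<eta> * \<delta>"
    have \<psi>\<delta>: "\<delta> * \<omega> \<delta> = 1 / \<bar>l\<bar>" and "\<delta> \<ge> 0"
      using h[of "1 / \<bar>l\<bar>"] by (auto simp: \<delta>_def \<psi>_def)
    then have \<delta>0: "\<delta> > 0" using l by (cases "\<delta> = 0") auto
    have "\<psi> \<delta> \<le> \<psi> (h 1)" using \<psi>\<delta> h(2)[of 1] l by (simp add: \<psi>_def)
    then have \<delta>1: "\<delta> \<le> h 1"
      using strict_mono_onD[OF smono, of "h 1" \<delta>] \<delta>0 h1 by fastforce
    have r0: "0 < r" using \<eta> \<delta>0 by (simp add: r_def)
    have r_le: "r \<le> \<eta> * h 1" using \<eta> \<delta>1 by (simp add: r_def)
    have rd: "r < d"
    proof -
      have "\<eta> * h 1 \<le> d / 2" using \<eta>(3) h1 by (simp add: field_simps)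
      then show ?thesis using r_le d by linarith
    qed
    have rm: "m * r \<le> 1 / 4"
    proof -
      have "m * (\<eta> * h 1) \<le> 1 / 4" using \<eta>(4) h1 m by (simp add: field_simps)
      then show ?thesis using mult_left_mono[OF r_le, of "real m"] by linarith
    qed
    have taylor: "\<bar>l\<bar> * \<bar>\<phi> (u + s) - \<phi> u - gradient \<phi> u \<bullet> s\<bar> \<le> 1 / 8" if "norm s \<le> r" for u s
    proof -
      have "\<bar>\<phi> (u + s) - \<phi> u - gradient \<phi> u \<bullet> s\<bar> \<le> CARD('m) * (norm s * (C * \<omega> r))"
        using osc[OF r0 rd] that pos[OF r0] by (intro partial_derivs_taylor pd) (auto intro: order_trans)
      also have "\<dots> \<le> m * (r * (C * \<omega> \<delta>))"
      proof -
        have "r \<le> 1 * \<delta>" unfolding r_def using \<eta> \<delta>0 by (intro mult_right_mono) auto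
        then have "\<omega> r \<le> \<omega> \<delta>" using mono_onD[OF assms(4), of r \<delta>] r0 by simp
        then have "norm s * (C * \<omega> r) \<le> r * (C * \<omega> \<delta>)"
          using that C r0 pos[OF r0] by (intro mult_mono mult_left_mono mult_nonneg_nonneg) auto
        then show ?thesis unfolding m_def by (rule mult_left_mono) simp
      qed
      \<comment> \<open>Here the choice of \<delta> pays off: \<delta> \<omega>(\<delta>) = 1 / |l|
        cancels the factor |l| in the phase.\<close>
      also have "\<dots> = m * \<eta> * C * (1 / \<bar>l\<bar>)" by (simp add: r_def \<psi>\<delta>[symmetric] mult_ac)
      finally have "\<bar>l\<bar> * \<bar>\<phi> (u + s) - \<phi> u - gradient \<phi> u \<bullet> s\<bar> \<le> \<bar>l\<bar> * (m * \<eta> * C * (1 / \<bar>l\<bar>))"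
        by (intro mult_left_mono) auto
      also have "\<dots> = m * \<eta> * C" using l by simp
      also have "\<dots> \<le> 1 / 8" using \<eta>(5) C m by (simp add: field_simps)
      finally show ?thesis .
    qed
    have "l \<noteq> 0" using l by auto
    have "\<mu> powr (1 / p) / (2 * (90 * real m * (2 * real m) ^ m) ^ m) * (\<bar>l\<bar> powr (1 / p) * r) ^ m
        \<le> Ap_norm p (\<lambda>t. cis (l * \<phi> t))"
      unfolding m_def
      by (rule Ap_norm_cis_lower_bound[OF assms(1) l(1) \<open>l \<noteq> 0\<close> per cont r0 rm[unfolded m_def] taylor \<mu>])
    then show ?thesis by (simp add: c_def r_def \<delta>_def power_mult_distrib mult_ac)
  qed
  ultimately show ?thesis unfolding h_def \<psi>_def m_def by blast
qed

end
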